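(* Let $G$ be a $3$-connected cubic plane bipartite graph whose faces are properly $3$-colored with color set $\{1,2,3\}$, and such that the outer face of $G$ is a $3$-face. Then the following statements are equivalent: (i) $G$ has a hamiltonian cycle $C$ such that all $2$-faces lie inside $C$, all $3$-faces lie outside $C$, and the $1$-faces lie on either side; (ii) the reduced graph $H$ obtained from $G$ by contracting each $1$-face to a single vertex has an $A$-trail; (iii) the reduced graph $H'$ obtained from $G$ by contracting each $2$-face to a single vertex has a spanning tree of faces consisting of $1$-faces (i.e. faces of $H'$ coming from $1$-faces of $G$); (iv) the reduced graph $H''$ obtained from $G$ by contracting each $3$-face to a single vertex has a spanning tree of faces consisting of $1$-faces.
   Context: A proper face-coloring assigns different colors to faces sharing an edge; faces of color $x$ are called $x$-faces. The faces of each color class form a facial $2$-factor, and contracting each face of one color class to a vertex yields a plane eulerian (multi)graph. An $A$-trail in a plane eulerian graph is an eulerian trail such that, whenever $e_i,e_j$ are consecutive edges of the trail at a vertex $v$ and $\langle e_1,\dots,e_{\deg(v)}\rangle$ is the counterclockwise cyclic ordering of the edges at $v$, then $j=i\pm1 \pmod{\deg(v)}$. For a $2$-connected plane graph $H$, the radial graph $\mathcal{R}(H)$ is the bipartite graph on $V(H)\cup\mathcal{F}(H)$ ($\mathcal{F}(H)$ the set of faces) with $x\sim f$ iff $x$ lies on the boundary of $f$; for a set $\mathcal{T}$ of bounded faces, $\mathcal{T}$ is a spanning tree of faces if the subgraph of $\mathcal{R}(H)$ induced by $V(H)\cup\mathcal{T}$ is a tree. *)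

theory Defs
  imports Main
begin

section \<open>Combinatorial maps (rotation systems) as plane graphs\<close>

text \<open>A plane (multi)graph is represented by a combinatorial map: a finite set of darts
(half-edges), a fixed-point-free involution cm_alpha (the other half of the same edge) and a
permutation cm_sigma (the counterclockwise successor of a dart around its vertex).
Vertices are cm_sigma-orbits, edges are cm_alpha-orbits, faces are orbits of
cm_sigma o cm_alpha.  A connected map is plane (genus 0) iff V - E + F = 2.\<close>

record 'd cmap =
  cm_darts :: "'d set"
  cm_alpha :: "'d \<Rightarrow> 'd"
  cm_sigma :: "'d \<Rightarrow> 'd"

definition orb :: "('d \<Rightarrow> 'd) \<Rightarrow> 'd \<Rightarrow> 'd set" where
  "orb f x = range (\<lambda>n. (f ^^ n) x)"

definition vert_of :: "'d cmap \<Rightarrow> 'd \<Rightarrow> 'd set" where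
  "vert_of M d = orb (cm_sigma M) d"

definition edge_of :: "'d cmap \<Rightarrow> 'd \<Rightarrow> 'd set" where
  "edge_of M d = orb (cm_alpha M) d"

definition cm_phi :: "'d cmap \<Rightarrow> 'd \<Rightarrow> 'd" where
  "cm_phi M = cm_sigma M \<circ> cm_alpha M"

definition face_of :: "'d cmap \<Rightarrow> 'd \<Rightarrow> 'd set" where
  "face_of M d = orb (cm_phi M) d"

definition verts :: "'d cmap \<Rightarrow> 'd set set" where
  "verts M = vert_of M ` cm_darts M"

definition edges :: "'d cmap \<Rightarrow> 'd set set" where
  "edges M = edge_of M ` cm_darts M"

definition faces :: "'d cmap \<Rightarrow> 'd set set" where
  "faces M = face_of M ` cm_darts M"

definition is_map :: "'d cmap \<Rightarrow> bool" where
  "is_map M \<longleftrightarrow> finite (cm_darts M) \<and> cm_darts M \<noteq> {}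
     \<and> bij_betw (cm_alpha M) (cm_darts M) (cm_darts M)
     \<and> bij_betw (cm_sigma M) (cm_darts M) (cm_darts M)
     \<and> (\<forall>d\<in>cm_darts M. cm_alpha M (cm_alpha M d) = d \<and> cm_alpha M d \<noteq> d)"

definition map_connected :: "'d cmap \<Rightarrow> bool" where
  "map_connected M \<longleftrightarrow>
     (\<forall>d\<in>cm_darts M. \<forall>e\<in>cm_darts M.
        (d, e) \<in> ({(x, cm_alpha M x) | x. x \<in> cm_darts M}
                  \<union> {(x, cm_sigma M x) | x. x \<in> cm_darts M})\<^sup>*)"

text \<open>Connected map of genus 0, i.e. a connected plane graph (embedded in the sphere).\<close>
definition plane_map :: "'d cmap \<Rightarrow> bool" where
  "plane_map M \<longleftrightarrow> is_map M \<and> map_connected M \<and>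
     int (card (verts M)) - int (card (edges M)) + int (card (faces M)) = 2"

section \<open>Graph-theoretic properties of the underlying graph\<close>

definition adj_rel :: "'d cmap \<Rightarrow> ('d set \<times> 'd set) set" where
  "adj_rel M = {(vert_of M d, vert_of M (cm_alpha M d)) | d. d \<in> cm_darts M}"

definition simple_map :: "'d cmap \<Rightarrow> bool" where
  "simple_map M \<longleftrightarrow>
     (\<forall>d\<in>cm_darts M. vert_of M (cm_alpha M d) \<noteq> vert_of M d) \<and>
     (\<forall>d\<in>cm_darts M. \<forall>e\<in>cm_darts M.
        vert_of M d = vert_of M e \<and> vert_of M (cm_alpha M d) = vert_of M (cm_alpha M e)
        \<longrightarrow> d = e)"

definition cubic_map :: "'d cmap \<Rightarrow> bool" where
  "cubic_map M \<longleftrightarrow> (\<forall>v\<in>verts M. card v = 3)"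

definition bipartite_map :: "'d cmap \<Rightarrow> bool" where
  "bipartite_map M \<longleftrightarrow>
     (\<exists>A. \<forall>d\<in>cm_darts M. vert_of M d \<in> A \<longleftrightarrow> vert_of M (cm_alpha M d) \<notin> A)"

text \<open>The underlying graph (simple, by assumption) is 3-connected: it has more than 3 vertices
and deleting any set of at most 2 vertices leaves a connected graph.\<close>
definition three_connected :: "'d cmap \<Rightarrow> bool" where
  "three_connected M \<longleftrightarrow> card (verts M) > 3 \<and>
     (\<forall>S \<subseteq> verts M. card S < 3 \<longrightarrow>
        (\<forall>u\<in>verts M - S. \<forall>v\<in>verts M - S.
           (u, v) \<in> (adj_rel M \<inter> ((verts M - S) \<times> (verts M - S)))\<^sup>*))"

section \<open>Face colourings\<close>

text \<open>Proper face colouring with colours 1,2,3: the two faces on the sides of any edge get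
different colours.\<close>
definition proper_3_face_colouring :: "'d cmap \<Rightarrow> ('d set \<Rightarrow> nat) \<Rightarrow> bool" where
  "proper_3_face_colouring M col \<longleftrightarrow>
     (\<forall>f\<in>faces M. col f \<in> {1, 2, 3}) \<and>
     (\<forall>d\<in>cm_darts M. col (face_of M d) \<noteq> col (face_of M (cm_alpha M d)))"

definition colour_class :: "'d cmap \<Rightarrow> ('d set \<Rightarrow> nat) \<Rightarrow> nat \<Rightarrow> 'd set set" where
  "colour_class M col x = {f \<in> faces M. col f = x}"

section \<open>Hamiltonian cycles and the two sides of a cycle\<close>

text \<open>A hamiltonian cycle given as a set C of darts closed under cm_alpha (i.e. a set of edges):
a connected spanning 2-regular subgraph.\<close>
definition ham_cycle :: "'d cmap \<Rightarrow> 'd set \<Rightarrow> bool" where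
  "ham_cycle M C \<longleftrightarrow> C \<subseteq> cm_darts M \<and> (\<forall>d\<in>C. cm_alpha M d \<in> C) \<and>
     (\<forall>v\<in>verts M. card (v \<inter> C) = 2) \<and>
     (\<forall>u\<in>verts M. \<forall>v\<in>verts M.
        (u, v) \<in> {(vert_of M d, vert_of M (cm_alpha M d)) | d. d \<in> C}\<^sup>*)"

text \<open>A face lies outside the cycle C (whose vertex set is all of V) iff it can be reached
from the outer face by crossing edges not in C; otherwise it lies inside C.\<close>
definition outside_cycle :: "'d cmap \<Rightarrow> 'd set \<Rightarrow> 'd set \<Rightarrow> 'd set \<Rightarrow> bool" where
  "outside_cycle M outer C f \<longleftrightarrow>
     (outer, f) \<in> {(face_of M d, face_of M (cm_alpha M d)) | d. d \<in> cm_darts M - C}\<^sup>*"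

definition inside_cycle :: "'d cmap \<Rightarrow> 'd set \<Rightarrow> 'd set \<Rightarrow> 'd set \<Rightarrow> bool" where
  "inside_cycle M outer C f \<longleftrightarrow> f \<in> faces M \<and> \<not> outside_cycle M outer C f"

section \<open>Contracting a colour class of faces of a cubic map\<close>

text \<open>Contract every face of the set X (a facial 2-factor of a cubic map) to a single vertex.
The surviving edges are those not on a face of X; the counterclockwise successor of a
surviving dart d around the new vertex is sigma (alpha (sigma d)).\<close>
definition contract_faces :: "'d cmap \<Rightarrow> 'd set set \<Rightarrow> 'd cmap" where
  "contract_faces M X =
     \<lparr> cm_darts = {d \<in> cm_darts M. face_of M d \<notin> X \<and> face_of M (cm_alpha M d) \<notin> X},
       cm_alpha = cm_alpha M,
       cm_sigma = (\<lambda>d. cm_sigma M (cm_alpha M (cm_sigma M d))) \<rparr>"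

definition reduced_graph :: "'d cmap \<Rightarrow> ('d set \<Rightarrow> nat) \<Rightarrow> nat \<Rightarrow> 'd cmap" where
  "reduced_graph M col x = contract_faces M (colour_class M col x)"

text \<open>A face of a reduced graph comes from the face of G containing its darts.\<close>
definition face_from_colour ::
  "'d cmap \<Rightarrow> ('d set \<Rightarrow> nat) \<Rightarrow> nat \<Rightarrow> 'd cmap \<Rightarrow> 'd set \<Rightarrow> bool" where
  "face_from_colour G col x H f \<longleftrightarrow> f \<in> faces H \<and> (\<exists>d\<in>f. col (face_of G d) = x)"

section \<open>A-trails\<close>

text \<open>A closed eulerian trail, as a cyclic list of darts: the i-th dart is the direction in
which the i-th edge is traversed.\<close>
definition eulerian_trail :: "'d cmap \<Rightarrow> 'd list \<Rightarrow> bool" where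
  "eulerian_trail M ds \<longleftrightarrow> ds \<noteq> [] \<and> distinct ds \<and> set ds \<subseteq> cm_darts M \<and>
     (\<forall>d\<in>cm_darts M. d \<in> set ds \<or> cm_alpha M d \<in> set ds) \<and>
     (\<forall>d\<in>set ds. cm_alpha M d \<notin> set ds) \<and>
     (\<forall>i<length ds. vert_of M (cm_alpha M (ds ! i)) = vert_of M (ds ! ((i + 1) mod length ds)))"

text \<open>A-trail: consecutive edges of the trail at a vertex are consecutive in the
counterclockwise rotation at that vertex.\<close>
definition A_trail :: "'d cmap \<Rightarrow> 'd list \<Rightarrow> bool" where
  "A_trail M ds \<longleftrightarrow> eulerian_trail M ds \<and>
     (\<forall>i<length ds.
        ds ! ((i + 1) mod length ds) = cm_sigma M (cm_alpha M (ds ! i)) \<or>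
        cm_alpha M (ds ! i) = cm_sigma M (ds ! ((i + 1) mod length ds)))"

section \<open>Radial graph and spanning trees of faces\<close>

definition graph_connected :: "'v set \<Rightarrow> ('v \<times> 'v) set \<Rightarrow> bool" where
  "graph_connected Vs Es \<longleftrightarrow> (\<forall>u\<in>Vs. \<forall>v\<in>Vs. (u, v) \<in> (Es \<union> Es\<inverse>)\<^sup>*)"

text \<open>A tree: nonempty, connected, and every edge is a bridge (minimally connected).\<close>
definition is_tree :: "'v set \<Rightarrow> ('v \<times> 'v) set \<Rightarrow> bool" where
  "is_tree Vs Es \<longleftrightarrow> Vs \<noteq> {} \<and> Es \<subseteq> Vs \<times> Vs \<and> graph_connected Vs Es \<and>
     (\<forall>e\<in>Es. \<not> graph_connected Vs (Es - {e}))"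

text \<open>Subgraph of the radial graph induced by V(H) and a set T of faces.\<close>
definition radial_edges :: "'d cmap \<Rightarrow> 'd set set \<Rightarrow> ('d set + 'd set) rel" where
  "radial_edges H T = {(Inl x, Inr f) | x f. x \<in> verts H \<and> f \<in> T \<and> x \<inter> f \<noteq> {}}"

definition spanning_tree_of_faces :: "'d cmap \<Rightarrow> 'd set \<Rightarrow> 'd set set \<Rightarrow> bool" where
  "spanning_tree_of_faces H outer T \<longleftrightarrow> T \<subseteq> faces H - {outer} \<and>
     is_tree (Inl ` verts H \<union> Inr ` T) (radial_edges H T)"

end

theory Submission
  imports Defs
begin

text \<open>Let \<open>T\<close> be a set of 1-faces, to be thought of as the 1-faces inside the cycle. All edges between
2- and 3-faces, the 13-edges of the faces in \<open>T\<close> and the 12-edges of the other 1-faces form a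
2-factor of \<open>G\<close>, and each of the four statements says that for some \<open>T\<close> this 2-factor is a single cycle.
For the hamiltonian cycle and for the A-trail this comes from alternation around each 1-face.

For the spanning trees, consider the graph whose vertices are the 2-faces and the faces in \<open>T\<close>, and
whose edges are the 12-edges of faces in \<open>T\<close>; dually, the graph on the 3-faces and the remaining
1-faces. If the 2-factor is a single cycle, both graphs are connected, and by Euler's formula
they have two edges fewer than vertices in total, so both are trees. Conversely, the vertex set of
a component of the 2-factor is entered as often as it is left when one goes around a face; this is
a circulation on the first graph, which vanishes if that graph is a tree. Then the component
contains all vertices. As the radial graph has no multiple edges, one also needs that two faces of a
3-connected cubic plane graph share at most one edge.\<close>

section \<open>Orbits of permutations of a finite set\<close>

text \<open>Call the 2-faces and the faces in \<open>T\<close> the inner region and all other faces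
  the outer region. The 2-factor consists exactly of the edges that have one side in each region.
  The remaining edges have both sides in the same region, and they are the edges of the two graphs
  of the overview. Exchanging the colours 2 and 3 and replacing \<open>T\<close> by its complement
  exchanges the regions and keeps their common boundary. So each fact about the inner region also
  holds for the outer one, and (iv) is (iii) with the colours exchanged. No closed curve has to be
  shown to separate the plane: planarity enters through counting. If there are 2n vertices, then
  there are 3n edges and n + 2 faces. The edges with both sides in one region are n in number, since
  each 1-face has as many 12-edges as 13-edges; this is where the two missing edges come from.
  Connectivity is expressed by two-colourings because a colouring of the vertices that is constant
  along the 2-factor and a colouring of the faces that is constant across the other edges can be
  turned into each other.\<close>

lemma orb_self: "d \<in> orb f d"
  unfolding orb_def by (rule range_eqI[of _ _ 0]) simp

lemma orb_step:
  assumes "e \<in> orb f d" shows "f e \<in> orb f d"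
proof -
  obtain n where "e = (f ^^ n) d" using assms unfolding orb_def by blast
  then have "f e = (f ^^ Suc n) d" by simp
  then show ?thesis unfolding orb_def by (rule range_eqI)
qed

lemma orb_induct [consumes 1, case_names self step]:
  assumes "e \<in> orb f d" "P d" "\<And>e. e \<in> orb f d \<Longrightarrow> P e \<Longrightarrow> P (f e)"
  shows "P e"
proof -
  have "P ((f ^^ n) d)" for n
    by (induction n) (simp_all add: assms(2,3) orb_def)
  then show ?thesis using assms(1) unfolding orb_def by blast
qed

lemma orb_mono:
  assumes "e \<in> orb f d" shows "orb f e \<subseteq> orb f d"
proof
  fix g assume "g \<in> orb f e"
  then show "g \<in> orb f d" by (induction rule: orb_induct) (simp_all add: assms orb_step)
qed

context
  fixes f :: "'d \<Rightarrow> 'd" and D :: "'d set"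
  assumes fin: "finite D" and bij: "bij_betw f D D"
begin

lemma orb_subset:
  assumes "d \<in> D" shows "orb f d \<subseteq> D"
proof
  fix e assume "e \<in> orb f d"
  then show "e \<in> D"
    by (induction rule: orb_induct) (use assms bij in \<open>auto dest: bij_betwE\<close>)
qed

text \<open>As \<open>f\<close> is injective, a repetition among the iterates can be pulled back to
  the start, so the first value to recur is \<open>d\<close> itself. Forward iterates therefore run
  through a whole cycle. The enumeration without repetition later yields the three darts of a vertex
  and the list of darts of an A-trail.\<close>

lemma orb_period:
  assumes d: "d \<in> D"
  obtains n where "n > 0" "(f ^^ n) d = d" "inj_on (\<lambda>i. (f ^^ i) d) {..<n}"
    "orb f d = (\<lambda>i. (f ^^ i) d) ` {..<n}"
proof -
  have inD: "(f ^^ i) d \<in> D" for i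
    using orb_subset[OF d] unfolding orb_def by (metis rangeI subsetD)
  have shift_back: "(f ^^ (j - i)) d = d" if "(f ^^ i) d = (f ^^ j) d" "i \<le> j" for i j
    using that
  proof (induction i arbitrary: j)
    case 0
    from 0(1) show ?case by (metis diff_zero funpow_0)
  next
    case (Suc i)
    obtain j' where j': "j = Suc j'" using Suc.prems(2) by (cases j) auto
    have "(f ^^ i) d = (f ^^ j') d"
      using inj_onD[OF bij_betw_imp_inj_on[OF bij] _ inD inD, of i j'] Suc.prems j' by simp
    then show ?case using Suc.IH[of j'] Suc.prems(2) j' by simp
  qed
  have "\<not> inj (\<lambda>i. (f ^^ i) d)"
    using finite_subset[OF orb_subset[OF d] fin] unfolding orb_def
    using finite_imageD infinite_UNIV_nat by blast
  then obtain i j where ij: "i < j" "(f ^^ i) d = (f ^^ j) d"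
    unfolding inj_def by (metis linorder_neqE_nat)
  define n where "n = (LEAST n. n > 0 \<and> (f ^^ n) d = d)"
  have "\<exists>n. n > 0 \<and> (f ^^ n) d = d"
    using shift_back[OF ij(2)] ij(1) by (intro exI[of _ "j - i"]) auto
  then have n: "n > 0" "(f ^^ n) d = d"
    unfolding n_def by (metis (mono_tags, lifting) LeastI_ex)+
  have min: "\<not> (m > 0 \<and> (f ^^ m) d = d)" if "m < n" for m
    using that unfolding n_def by (rule not_less_Least)
  have inj: "inj_on (\<lambda>i. (f ^^ i) d) {..<n}"
  proof (rule linorder_inj_onI)
    fix i j assume "i < j" "i \<in> {..<n}" "j \<in> {..<n}"
    then show "(f ^^ i) d \<noteq> (f ^^ j) d"
      using shift_back[of i j] min[of "j - i"] by auto
  qed auto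
  have "orb f d = (\<lambda>i. (f ^^ i) d) ` {..<n}"
  proof
    show "orb f d \<subseteq> (\<lambda>i. (f ^^ i) d) ` {..<n}"
    proof
      fix e assume "e \<in> orb f d"
      then show "e \<in> (\<lambda>i. (f ^^ i) d) ` {..<n}"
      proof (induction rule: orb_induct)
        case self
        show ?case by (rule image_eqI[of _ _ 0]) (use n in auto)
      next
        case (step e)
        then obtain i where i: "i < n" "e = (f ^^ i) d" by auto
        show ?case
        proof (cases "Suc i = n")
          case True
          then have "f e = (f ^^ 0) d" using i n by auto
          then show ?thesis using n by blast
        next
          case False
          then have "f e = (f ^^ Suc i) d" "Suc i < n" using i by auto
          then show ?thesis by blast
        qed
      qed
    qed
  qed (auto simp: orb_def)
  with n inj that show ?thesis by blast
qed

lemma orb_sym: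
  assumes "d \<in> D" "e \<in> orb f d" shows "d \<in> orb f e"
proof -
  obtain n where n: "n > 0" "(f ^^ n) d = d" "orb f d = (\<lambda>i. (f ^^ i) d) ` {..<n}"
    using orb_period[OF assms(1)] by metis
  then obtain i where i: "i < n" "e = (f ^^ i) d" using assms(2) by auto
  have "(f ^^ (n - i)) e = (f ^^ (n - i + i)) d" unfolding i(2) funpow_add by simp
  also have "\<dots> = d" using i n by simp
  finally show ?thesis unfolding orb_def by (metis rangeI)
qed

lemma orb_eq:
  assumes "d \<in> D" "e \<in> orb f d" shows "orb f e = orb f d"
  using orb_mono[OF assms(2)] orb_mono[OF orb_sym[OF assms]] by blast

lemma orb_shift: "d \<in> D \<Longrightarrow> orb f (f d) = orb f d"
  by (rule orb_eq[OF _ orb_step[OF orb_self]])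

lemma bij_betw_orb:
  assumes "d \<in> D" shows "bij_betw f (orb f d) (orb f d)"
proof -
  have sub: "orb f d \<subseteq> D" by (rule orb_subset[OF assms])
  have "inj_on f (orb f d)"
    using bij sub by (metis bij_betw_def inj_on_subset)
  moreover have "f ` orb f d \<subseteq> orb f d" using orb_step by fastforce
  ultimately show ?thesis
    using finite_subset[OF sub fin] by (simp add: bij_betw_def endo_inj_surj)
qed

lemma sum_telescope_orb:
  fixes w :: "'d \<Rightarrow> int"
  assumes "d \<in> D" shows "(\<Sum>e\<in>orb f d. w e - w (f e)) = 0"
  using sum.reindex_bij_betw[OF bij_betw_orb[OF assms], of w] by (simp add: sum_subtractf)

end

section \<open>Connected multigraphs\<close>

text \<open>Connectivity is phrased by two-colourings: a colouring of the vertices that is constant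
along every edge is constant.\<close>

definition conn :: "'v set \<Rightarrow> 'i set \<Rightarrow> ('i \<Rightarrow> 'v) \<Rightarrow> ('i \<Rightarrow> 'v) \<Rightarrow> bool" where
  "conn V I s t \<longleftrightarrow>
     (\<forall>Q :: 'v \<Rightarrow> bool. (\<forall>i\<in>I. Q (s i) = Q (t i)) \<longrightarrow> (\<forall>u\<in>V. \<forall>v\<in>V. Q u = Q v))"

lemma connI:
  assumes "\<And>Q u v. (\<And>i. i \<in> I \<Longrightarrow> Q (s i) = Q (t i)) \<Longrightarrow> u \<in> V \<Longrightarrow> v \<in> V \<Longrightarrow> Q u \<Longrightarrow> Q v"
  shows "conn V I s t"
  unfolding conn_def
proof (intro allI impI ballI)
  fix Q :: "_ \<Rightarrow> bool" and u v
  assume "\<forall>i\<in>I. Q (s i) = Q (t i)" "u \<in> V" "v \<in> V"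
  then show "Q u = Q v" using assms[of Q u v] assms[of Q v u] by blast
qed

lemma connD:
  assumes "conn V I s t" "\<And>i. i \<in> I \<Longrightarrow> Q (s i) = Q (t i)" "u \<in> V" "v \<in> V"
  shows "(Q u :: bool) = Q v"
proof -
  have "(\<forall>i\<in>I. Q (s i) = Q (t i)) \<longrightarrow> (\<forall>u\<in>V. \<forall>v\<in>V. Q u = Q v)"
    using assms(1) unfolding conn_def by (rule spec)
  then show ?thesis using assms(2-4) by blast
qed

lemma conn_mono:
  assumes "conn V J s t" "J \<subseteq> I" shows "conn V I s t"
proof (rule connI)
  fix Q u v assume "\<And>i. i \<in> I \<Longrightarrow> Q (s i) = Q (t i)" "u \<in> V" "v \<in> V" "Q u"
  then show "Q v" using connD[OF assms(1), of Q u v] assms(2) by blast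
qed

lemma spanning_tree_exists:
  assumes fin: "finite V" "finite I" and ne: "V \<noteq> {}"
    and ends: "\<And>i. i \<in> I \<Longrightarrow> s i \<in> V" "\<And>i. i \<in> I \<Longrightarrow> t i \<in> V"
    and conn: "conn V I s t"
  obtains J where "J \<subseteq> I" "conn V J s t" "card J + 1 = card V"
proof -
  have grow: "\<exists>W J. W \<subseteq> V \<and> J \<subseteq> I \<and> s ` J \<subseteq> W \<and> t ` J \<subseteq> W \<and> conn W J s t
      \<and> card J = k \<and> card W = Suc k" if "Suc k \<le> card V" for k
    using that
  proof (induction k)
    case 0
    obtain v where "v \<in> V" using ne by blast
    then show ?case
      by (intro exI[of _ "{v}"] exI[of _ "{}"]) (auto simp: conn_def)
  next
    case (Suc k)
    then obtain W J where WJ: "W \<subseteq> V" "J \<subseteq> I" "s ` J \<subseteq> W" "t ` J \<subseteq> W" "conn W J s t"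
      "card J = k" "card W = Suc k" by auto
    obtain r where r: "r \<in> W" using WJ(7) by fastforce
    obtain v where v: "v \<in> V" "v \<notin> W"
      using WJ(1,7) Suc.prems fin by (metis Suc_n_not_le_n subset_antisym subsetI)
    \<comment> \<open>Otherwise membership in \<open>W\<close> would be a colouring that is constant
      along every edge but separates \<open>r\<close> from \<open>v\<close>. The edge found here
      leaves \<open>W\<close>, and \<open>u\<close> is its end outside.\<close>
    have "\<not> (\<forall>i\<in>I. (s i \<in> W) = (t i \<in> W))"
      using connD[OF conn, of "\<lambda>v. v \<in> W" r v] r v WJ(1) by blast
    then obtain i where i: "i \<in> I" "(s i \<in> W) \<noteq> (t i \<in> W)" by blast
    define u where "u = (if s i \<in> W then t i else s i)"
    have u: "u \<in> V" "u \<notin> W" "insert u W = insert (s i) (insert (t i) W)"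
      using i ends unfolding u_def by (auto split: if_splits)
    have "i \<notin> J" using i WJ(3,4) by blast
    have "conn (insert u W) (insert i J) s t"
    proof (rule connI)
      fix Q a b
      assume Q: "\<And>j. j \<in> insert i J \<Longrightarrow> Q (s j) = Q (t j)"
        and ab: "a \<in> insert u W" "b \<in> insert u W" "Q a"
      have "Q w = Q r" if "w \<in> W" for w
        using connD[OF WJ(5), of Q w r] Q that r by blast
      moreover have "Q u = Q r"
        using calculation Q[of i] i unfolding u_def by (auto split: if_splits)
      ultimately show "Q b" using ab by blast
    qed
    moreover have "card (insert i J) = Suc k" "card (insert u W) = Suc (Suc k)"
      using \<open>i \<notin> J\<close> u(2) WJ fin by (simp_all add: finite_subset)
    moreover have "s ` insert i J \<subseteq> insert u W" "t ` insert i J \<subseteq> insert u W"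
      using WJ u(3) by auto
    ultimately show ?case
      using WJ(1,2) u(1) i(1)
      by (intro exI[of _ "insert u W"] exI[of _ "insert i J"]) simp
  qed
  have "card V > 0" using ne fin by (simp add: card_gt_0_iff)
  then obtain W J where WJ: "W \<subseteq> V" "J \<subseteq> I" "conn W J s t"
      "card J = card V - 1" "card W = card V"
    using grow[of "card V - 1"] by auto
  then have "W = V" using fin by (simp add: card_subset_eq)
  then show ?thesis using that[of J] WJ \<open>card V > 0\<close> by simp
qed

lemma conn_card_le:
  assumes "finite V" "finite I"
    and "\<And>i. i \<in> I \<Longrightarrow> s i \<in> V" "\<And>i. i \<in> I \<Longrightarrow> t i \<in> V" and "conn V I s t"
  shows "card V \<le> card I + 1"
proof (cases "V = {}")
  case False
  then obtain J where "J \<subseteq> I" "card J + 1 = card V"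
    using spanning_tree_exists[OF assms(1,2) _ assms(3-5)] by metis
  then show ?thesis using card_mono[OF assms(2), of J] by linarith
qed simp

text \<open>Deleting the bridge leaves a colouring \<open>Q\<close> that only \<open>e\<close>
  violates. When the conservation law is summed over the vertices with \<open>Q\<close>, every other
  edge contributes equally to both sides, and only \<open>w e\<close> is left over.\<close>

lemma circulation_on_bridge:
  fixes w :: "'i \<Rightarrow> int"
  assumes fin: "finite V" "finite I"
    and ends: "\<And>i. i \<in> I \<Longrightarrow> s i \<in> V" "\<And>i. i \<in> I \<Longrightarrow> t i \<in> V"
    and conn: "conn V I s t" and e: "e \<in> I" and bridge: "\<not> conn V (I - {e}) s t"
    and cons: "\<And>v. v \<in> V \<Longrightarrow> (\<Sum>i | i \<in> I \<and> s i = v. w i) = (\<Sum>i | i \<in> I \<and> t i = v. w i)"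
  shows "w e = 0"
proof -
  obtain Q :: "_ \<Rightarrow> bool" and u v where Q: "\<And>i. i \<in> I - {e} \<Longrightarrow> Q (s i) = Q (t i)"
    and uv: "u \<in> V" "v \<in> V" "Q u \<noteq> Q v"
    using bridge unfolding conn_def by blast
  have Qe: "Q (s e) \<noteq> Q (t e)"
  proof
    assume "Q (s e) = Q (t e)"
    then have "Q (s i) = Q (t i)" if "i \<in> I" for i using Q that by (cases "i = e") auto
    then show False using connD[OF conn, of Q u v] uv by blast
  qed
  have split: "(\<Sum>v | v \<in> V \<and> Q v. \<Sum>i | i \<in> I \<and> g i = v. w i)
      = (\<Sum>i\<in>I. if Q (g i) then w i else 0)" if "\<And>i. i \<in> I \<Longrightarrow> g i \<in> V" for g
  proof -
    have "(\<Sum>v | v \<in> V \<and> Q v. \<Sum>i | i \<in> I \<and> g i = v. w i)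
        = (\<Sum>v | v \<in> V \<and> Q v. \<Sum>i | i \<in> {i\<in>I. Q (g i)} \<and> g i = v. w i)"
      by (rule sum.cong[OF refl], rule sum.cong) auto
    also have "\<dots> = (\<Sum>i | i \<in> I \<and> Q (g i). w i)"
      by (rule sum.group) (use fin that in auto)
    also have "\<dots> = (\<Sum>i\<in>I. if Q (g i) then w i else 0)"
      using fin by (simp add: sum.inter_filter)
    finally show ?thesis .
  qed
  have "(\<Sum>v | v \<in> V \<and> Q v. \<Sum>i | i \<in> I \<and> s i = v. w i)
      = (\<Sum>v | v \<in> V \<and> Q v. \<Sum>i | i \<in> I \<and> t i = v. w i)"
    by (rule sum.cong[OF refl]) (use cons in auto)
  then have "(\<Sum>i\<in>I. if Q (s i) then w i else 0) = (\<Sum>i\<in>I. if Q (t i) then w i else 0)"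
    using split[of s] split[of t] ends by simp
  moreover have "(\<Sum>i\<in>I - {e}. if Q (s i) then w i else 0)
      = (\<Sum>i\<in>I - {e}. if Q (t i) then w i else 0)"
    by (rule sum.cong[OF refl]) (use Q in auto)
  ultimately show "w e = 0"
    using Qe fin e by (auto simp: sum.remove[of I e] split: if_splits)
qed

lemma tree_edge_is_bridge:
  assumes "finite V" "finite I"
    and "\<And>i. i \<in> I \<Longrightarrow> s i \<in> V" "\<And>i. i \<in> I \<Longrightarrow> t i \<in> V"
    and "card I + 1 = card V" "e \<in> I"
  shows "\<not> conn V (I - {e}) s t"
proof
  assume "conn V (I - {e}) s t"
  then have "card V \<le> card (I - {e}) + 1"
    using conn_card_le[of V "I - {e}" s t] assms by auto
  moreover have "card (I - {e}) < card I" using assms(2,6) by (rule card_Diff1_less)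
  ultimately show False using assms(5) by linarith
qed

lemma graph_connected_iff_conn:
  "graph_connected V E \<longleftrightarrow> conn V E fst snd"
proof
  assume E: "graph_connected V E"
  show "conn V E fst snd"
  proof (rule connI)
    fix Q u v assume Q: "\<And>i. i \<in> E \<Longrightarrow> Q (fst i) = Q (snd i)" and uv: "u \<in> V" "v \<in> V" "Q u"
    have "(u, v) \<in> (E \<union> E\<inverse>)\<^sup>*" using E uv unfolding graph_connected_def by blast
    then show "Q v"
      by (induction rule: rtrancl_induct) (use Q uv in fastforce)+
  qed
next
  assume conn: "conn V E fst snd"
  show "graph_connected V E"
    unfolding graph_connected_def
  proof (intro ballI)
    fix u v assume uv: "u \<in> V" "v \<in> V"
    have "((u, fst i) \<in> (E \<union> E\<inverse>)\<^sup>*) = ((u, snd i) \<in> (E \<union> E\<inverse>)\<^sup>*)" if "i \<in> E" for i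
    proof -
      have "(fst i, snd i) \<in> E \<union> E\<inverse>" "(snd i, fst i) \<in> E \<union> E\<inverse>" using that by auto
      then show ?thesis by (meson rtrancl.rtrancl_into_rtrancl)
    qed
    then show "(u, v) \<in> (E \<union> E\<inverse>)\<^sup>*"
      using connD[OF conn, of "\<lambda>w. (u, w) \<in> (E \<union> E\<inverse>)\<^sup>*" u v] uv by blast
  qed
qed

text \<open>The pairs are reversed because a radial edge runs from a vertex to a face, whereas a
  glued dart has the \<open>x\<close>-face as its source and the \<open>y\<close>-face, later
  contracted to a vertex, as its target.\<close>

lemma conn_image_iff:
  assumes "inj_on \<nu> V" "\<And>i. i \<in> I \<Longrightarrow> s i \<in> V" "\<And>i. i \<in> I \<Longrightarrow> t i \<in> V"
  shows "conn (\<nu> ` V) ((\<lambda>i. (\<nu> (t i), \<nu> (s i))) ` I) fst snd \<longleftrightarrow> conn V I s t"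
proof
  assume conn: "conn (\<nu> ` V) ((\<lambda>i. (\<nu> (t i), \<nu> (s i))) ` I) fst snd"
  show "conn V I s t"
  proof (rule connI)
    fix Q u v assume Q: "\<And>i. i \<in> I \<Longrightarrow> Q (s i) = Q (t i)" and uv: "u \<in> V" "v \<in> V" "Q u"
    have inv: "the_inv_into V \<nu> (\<nu> w) = w" if "w \<in> V" for w
      using assms(1) that by (rule the_inv_into_f_f)
    have "Q (the_inv_into V \<nu> (\<nu> u)) = Q (the_inv_into V \<nu> (\<nu> v))"
      by (rule connD[OF conn, of "\<lambda>w. Q (the_inv_into V \<nu> w)"])
        (use Q uv assms inv in auto)
    then show "Q v" using inv uv by simp
  qed
next
  assume conn: "conn V I s t"
  show "conn (\<nu> ` V) ((\<lambda>i. (\<nu> (t i), \<nu> (s i))) ` I) fst snd"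
  proof (rule connI)
    fix Q u v
    assume Q: "\<And>i. i \<in> (\<lambda>i. (\<nu> (t i), \<nu> (s i))) ` I \<Longrightarrow> Q (fst i) = Q (snd i)"
      and uv: "u \<in> \<nu> ` V" "v \<in> \<nu> ` V" "Q u"
    then obtain u' v' where "u = \<nu> u'" "v = \<nu> v'" "u' \<in> V" "v' \<in> V" by blast
    moreover have "Q (\<nu> (s i)) = Q (\<nu> (t i))" if "i \<in> I" for i
      using Q[of "(\<nu> (t i), \<nu> (s i))"] that by auto
    ultimately show "Q v" using connD[OF conn, of "\<lambda>w. Q (\<nu> w)" u' v'] uv by blast
  qed
qed

lemma is_tree_imageI:
  assumes fin: "finite V" "finite I" and inj: "inj_on \<nu> V"
    and ends: "\<And>i. i \<in> I \<Longrightarrow> s i \<in> V" "\<And>i. i \<in> I \<Longrightarrow> t i \<in> V"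
    and conn: "conn V I s t" and card: "card I + 1 = card V"
  shows "is_tree (\<nu> ` V) ((\<lambda>i. (\<nu> (t i), \<nu> (s i))) ` I)" (is "is_tree ?V (?p ` I)")
  unfolding is_tree_def graph_connected_iff_conn
proof (intro conjI ballI)
  show "?V \<noteq> {}" using card by fastforce
  show "?p ` I \<subseteq> ?V \<times> ?V" using ends by auto
  show "conn ?V (?p ` I) fst snd" using conn_image_iff[where I=I and s=s and t=t, OF inj ends] conn by simp
  fix e assume "e \<in> ?p ` I"
  then obtain i where i: "i \<in> I" "e = ?p i" by blast
  \<comment> \<open>Several indices may share the pair \<open>e\<close>; deleting it deletes all of
    them, and the bridge \<open>i\<close> is among them.\<close>
  define J where "J = {j \<in> I. ?p j \<noteq> e}"
  have J: "?p ` I - {e} = ?p ` J" "J \<subseteq> I - {i}" unfolding J_def using i by auto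
  show "\<not> conn ?V (?p ` I - {e}) fst snd"
  proof
    assume "conn ?V (?p ` I - {e}) fst snd"
    then have "conn V J s t"
      unfolding J(1) using conn_image_iff[OF inj, of J s t] ends J(2) by auto
    then have "conn V (I - {i}) s t" using J(2) by (rule conn_mono)
    then show False
      using tree_edge_is_bridge[where s=s and t=t, OF fin ends card i(1)] by blast
  qed
qed

text \<open>Injectivity on the edges makes the deletion of a pair the deletion of a single index.
  Parallel edges would be merged into one pair and could hide a cycle of length two.\<close>

lemma is_tree_imageD:
  assumes inj: "inj_on \<nu> V" "inj_on (\<lambda>i. (\<nu> (t i), \<nu> (s i))) I"
    and ends: "\<And>i. i \<in> I \<Longrightarrow> s i \<in> V" "\<And>i. i \<in> I \<Longrightarrow> t i \<in> V"
    and tree: "is_tree (\<nu> ` V) ((\<lambda>i. (\<nu> (t i), \<nu> (s i))) ` I)" (is "is_tree ?V (?p ` I)")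
  shows "conn V I s t" "e \<in> I \<Longrightarrow> \<not> conn V (I - {e}) s t"
proof -
  show "conn V I s t"
    using tree conn_image_iff[where I=I and s=s and t=t, OF inj(1) ends]
    unfolding is_tree_def graph_connected_iff_conn by simp
  assume e: "e \<in> I"
  have "?p ` (I - {e}) = ?p ` I - {?p e}"
    using inj(2) e by (auto simp: inj_on_def)
  moreover have "\<not> conn ?V (?p ` I - {?p e}) fst snd"
    using tree e unfolding is_tree_def graph_connected_iff_conn by blast
  ultimately show "\<not> conn V (I - {e}) s t"
    using conn_image_iff[OF inj(1), of "I - {e}" s t] ends by auto
qed

section \<open>Cubic plane maps with coloured faces\<close>

text \<open>The colours are parameters so that the whole development can be instantiated again with
  \<open>y\<close> and \<open>z\<close> exchanged.\<close>

locale coloured_cubic_map =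
  fixes M :: "'d cmap" and col :: "'d set \<Rightarrow> nat" and x y z :: nat
  assumes plane: "plane_map M" and simple: "simple_map M" and three_conn: "three_connected M"
    and cubic: "cubic_map M"
    and colours: "f \<in> faces M \<Longrightarrow> col f \<in> {x, y, z}"
    and proper: "d \<in> cm_darts M \<Longrightarrow> col (face_of M d) \<noteq> col (face_of M (cm_alpha M d))"
    and distinct: "x \<noteq> y" "y \<noteq> z" "x \<noteq> z"
begin

abbreviation D where "D \<equiv> cm_darts M"
abbreviation al where "al \<equiv> cm_alpha M"
abbreviation sg where "sg \<equiv> cm_sigma M"
abbreviation F where "F \<equiv> face_of M"
abbreviation c where "c d \<equiv> col (face_of M d)"

lemma is_map: "is_map M" using plane unfolding plane_map_def by blast

lemma finite_D [simp]: "finite D" using is_map unfolding is_map_def by blast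
lemma D_nonempty: "D \<noteq> {}" using is_map unfolding is_map_def by blast
lemma bij_al: "bij_betw al D D" using is_map unfolding is_map_def by blast
lemma bij_sg: "bij_betw sg D D" using is_map unfolding is_map_def by blast
lemma al_in [simp]: "d \<in> D \<Longrightarrow> al d \<in> D" using bij_al bij_betwE by blast
lemma sg_in [simp]: "d \<in> D \<Longrightarrow> sg d \<in> D" using bij_sg bij_betwE by blast
lemma al_al [simp]: "d \<in> D \<Longrightarrow> al (al d) = d" using is_map unfolding is_map_def by blast

lemma bij_phi: "bij_betw (cm_phi M) D D"
  unfolding cm_phi_def by (rule bij_betw_trans[OF bij_al bij_sg])

lemma phi_eq: "cm_phi M d = sg (al d)" unfolding cm_phi_def by simp

lemma card_vert: "d \<in> D \<Longrightarrow> card (vert_of M d) = 3"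
  using cubic unfolding cubic_map_def verts_def by blast

lemma
  assumes "d \<in> D"
  shows sg_sg_sg [simp]: "sg (sg (sg d)) = d"
    and vert_of_eq: "vert_of M d = {d, sg d, sg (sg d)}"
proof -
  obtain n where n: "(sg ^^ n) d = d" "inj_on (\<lambda>i. (sg ^^ i) d) {..<n}"
    "orb sg d = (\<lambda>i. (sg ^^ i) d) ` {..<n}"
    using orb_period[OF finite_D bij_sg assms] by metis
  have "n = 3" using card_vert[OF assms] n(2,3) unfolding vert_of_def by (simp add: card_image)
  then show "sg (sg (sg d)) = d" using n(1) by (simp add: numeral_3_eq_3)
  have "{..<3::nat} = {0, 1, 2}" by auto
  then show "vert_of M d = {d, sg d, sg (sg d)}"
    using n(3) \<open>n = 3\<close> unfolding vert_of_def by (auto simp: numeral_2_eq_2)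
qed

lemma vert_of_sg [simp]: "d \<in> D \<Longrightarrow> vert_of M (sg d) = vert_of M d"
  by (auto simp: vert_of_eq)

lemma vert_of_mem:
  assumes "d \<in> D" shows "e \<in> vert_of M d \<longleftrightarrow> e \<in> D \<and> vert_of M e = vert_of M d"
proof
  assume "e \<in> vert_of M d"
  then have "e = d \<or> e = sg d \<or> e = sg (sg d)" using vert_of_eq[OF assms] by simp
  then show "e \<in> D \<and> vert_of M e = vert_of M d" using assms by fastforce
next
  assume "e \<in> D \<and> vert_of M e = vert_of M d"
  then show "e \<in> vert_of M d" using vert_of_eq[of e] by blast
qed

lemma F_phi [simp]: "d \<in> D \<Longrightarrow> F (sg (al d)) = F d"
  using orb_shift[OF finite_D bij_phi, of d] unfolding face_of_def by (simp add: phi_eq)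

lemma F_al [simp]: "d \<in> D \<Longrightarrow> F (al d) = F (sg d)"
  using F_phi[of "al d"] by simp

lemma F_mem:
  assumes "d \<in> D" shows "e \<in> F d \<longleftrightarrow> e \<in> D \<and> F e = F d"
  using orb_eq[OF finite_D bij_phi assms, of e] orb_subset[OF finite_D bij_phi assms]
    orb_self[of e "cm_phi M"] unfolding face_of_def by auto

lemma F_in_faces [simp]: "d \<in> D \<Longrightarrow> F d \<in> faces M"
  unfolding faces_def by blast

lemma F_induct:
  assumes "d \<in> D" "e \<in> F d" "P d"
    "\<And>e. e \<in> D \<Longrightarrow> F e = F d \<Longrightarrow> P e \<Longrightarrow> P (sg (al e))"
  shows "P e"
proof -
  have "e \<in> orb (cm_phi M) d" using assms(2) unfolding face_of_def .
  then show ?thesis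
  proof (induction rule: orb_induct)
    case (step e)
    then have "e \<in> F d" unfolding face_of_def by simp
    then show ?case using assms(4)[of e] F_mem[OF assms(1)] step(2) by (simp add: phi_eq)
  qed (rule assms(3))
qed

lemma c_neq: "d \<in> D \<Longrightarrow> c (sg d) \<noteq> c d"
  using proper[of d] by simp

lemma col_cases:
  assumes "d \<in> D"
  obtains "c d = x" "c (sg d) = y" "c (sg (sg d)) = z"
  | "c d = y" "c (sg d) = z" "c (sg (sg d)) = x"
  | "c d = z" "c (sg d) = x" "c (sg (sg d)) = y"
  | "c d = x" "c (sg d) = z" "c (sg (sg d)) = y"
  | "c d = z" "c (sg d) = y" "c (sg (sg d)) = x"
  | "c d = y" "c (sg d) = x" "c (sg (sg d)) = z"
proof -
  have "c d \<in> {x, y, z}" "c (sg d) \<in> {x, y, z}" "c (sg (sg d)) \<in> {x, y, z}"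
    using assms by (simp_all only: colours F_in_faces sg_in)
  moreover have "c (sg d) \<noteq> c d" "c (sg (sg d)) \<noteq> c (sg d)" "c d \<noteq> c (sg (sg d))"
    using c_neq[of d] c_neq[of "sg d"] c_neq[of "sg (sg d)"] assms by auto
  ultimately show thesis using that by (elim insertE emptyE) auto
qed

text \<open>Both ends of an edge meet the two faces along it, so the same colour is left for the
  third face at either end. Assigning this colour to the edge gives a proper
  3-edge-colouring.\<close>

lemma c_third [simp]: "d \<in> D \<Longrightarrow> c (sg (sg (al d))) = c (sg (sg d))"
  by (rule col_cases[of d]; simp; rule col_cases[of "al d"]; simp add: distinct)

lemma map_conn:
  assumes "\<And>d. d \<in> D \<Longrightarrow> Q (sg d) = Q d" "\<And>d. d \<in> D \<Longrightarrow> Q (al d) = Q d" "d \<in> D" "e \<in> D"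
  shows "Q d = Q e"
proof -
  have "(d, e) \<in> ({(x, al x) | x. x \<in> D} \<union> {(x, sg x) | x. x \<in> D})\<^sup>*"
    using plane assms(3,4) unfolding plane_map_def map_connected_def by blast
  then show ?thesis by (induction rule: rtrancl_induct) (use assms(1,2) in auto)
qed

subsection \<open>The 2-factor determined by a set of faces\<close>

text \<open>\<open>face_of M d\<close> is the face to the right of \<open>d\<close>, and \<open>F (al d) = F (sg d)\<close> the one to its left, so the
three darts at a vertex carry the three colours, in opposite cyclic orders at the two ends of an edge.\<close>

definition cyc :: "'d set set \<Rightarrow> 'd set" where
  "cyc T = {d \<in> D. (c d \<noteq> x \<and> c (al d) \<noteq> x) \<or> (c d = x \<and> (c (al d) = z \<longleftrightarrow> F d \<in> T))
     \<or> (c (al d) = x \<and> (c d = z \<longleftrightarrow> F (al d) \<in> T))}"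

text \<open>Invariance under \<open>sg\<close> makes \<open>Q\<close> a colouring of the vertices,
  so this is connectivity of the spanning subgraph with edge set \<open>cyc T\<close>. As that
  subgraph is 2-regular, it is then one cycle.\<close>

definition single_cycle :: "'d set set \<Rightarrow> bool" where
  "single_cycle T \<longleftrightarrow> (\<forall>Q :: 'd \<Rightarrow> bool. (\<forall>d\<in>D. Q (sg d) = Q d) \<longrightarrow>
     (\<forall>d\<in>cyc T. Q (al d) = Q d) \<longrightarrow> (\<forall>d\<in>D. \<forall>e\<in>D. Q d = Q e))"

definition nodes :: "'d set set \<Rightarrow> 'd set set" where
  "nodes T = colour_class M col y \<union> T"

text \<open>The edges with the inner region on both sides, each represented by the dart that has the
  \<open>x\<close>-face on its right. As an edge of the graph on \<open>nodes T\<close> it runs from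
  \<open>F d\<close> to \<open>F (al d)\<close>.\<close>

definition glue :: "'d set set \<Rightarrow> 'd set" where
  "glue T = {d \<in> D. c d = x \<and> c (al d) = y \<and> F d \<in> T}"

lemma single_cycleI:
  assumes "\<And>(Q :: 'd \<Rightarrow> bool) d e. (\<And>d. d \<in> D \<Longrightarrow> Q (sg d) = Q d) \<Longrightarrow>
     (\<And>d. d \<in> cyc T \<Longrightarrow> Q (al d) = Q d) \<Longrightarrow> d \<in> D \<Longrightarrow> e \<in> D \<Longrightarrow> Q d = Q e"
  shows "single_cycle T"
  unfolding single_cycle_def
proof (intro allI impI ballI)
  fix Q :: "'d \<Rightarrow> bool" and d e
  assume "\<forall>d\<in>D. Q (sg d) = Q d" "\<forall>d\<in>cyc T. Q (al d) = Q d" "d \<in> D" "e \<in> D"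
  then show "Q d = Q e" using assms[of Q d e] by blast
qed

lemma single_cycleD:
  assumes "single_cycle T" "\<And>d. d \<in> D \<Longrightarrow> Q (sg d) = Q d"
    "\<And>d. d \<in> cyc T \<Longrightarrow> Q (al d) = Q d" "d \<in> D" "e \<in> D"
  shows "Q d = (Q e :: bool)"
proof -
  have "(\<forall>d\<in>D. Q (sg d) = Q d) \<longrightarrow> (\<forall>d\<in>cyc T. Q (al d) = Q d) \<longrightarrow> (\<forall>d\<in>D. \<forall>e\<in>D. Q d = Q e)"
    using assms(1) unfolding single_cycle_def by (rule spec)
  then show ?thesis using assms(2-5) by blast
qed

lemma colour_class_iff: "f \<in> colour_class M col k \<longleftrightarrow> (\<exists>d\<in>D. f = F d \<and> c d = k)"
  unfolding colour_class_def faces_def by auto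

lemma glue_ends:
  assumes "d \<in> glue T"
  shows "F d \<in> nodes T" "F (al d) \<in> nodes T"
  using assms unfolding glue_def nodes_def colour_class_def by auto

lemma cyc_subset: "cyc T \<subseteq> D"
  unfolding cyc_def by blast

lemma cyc_al:
  assumes "d \<in> cyc T" shows "al d \<in> cyc T"
proof -
  have d: "d \<in> D" using assms cyc_subset by blast
  show ?thesis
    using assms al_in[OF d] unfolding cyc_def mem_Collect_eq al_al[OF d] by blast
qed

section \<open>From the 2-factor to the graph of glued faces and back\<close>

definition ydart :: "'d \<Rightarrow> 'd" where
  "ydart d = (if c d = y then d else if c (sg d) = y then sg d else sg (sg d))"

lemma ydart:
  assumes "d \<in> D"
  shows "ydart d \<in> D" "c (ydart d) = y" "ydart (sg d) = ydart d"
  using assms distinct by (rule_tac col_cases[OF assms]; simp add: ydart_def)+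

text \<open>Give each vertex the colour of its \<open>y\<close>-face. An edge of the 2-factor that
  borders a \<open>y\<close>-face has this face at both ends. Any other one is an
  \<open>x\<close>-\<open>z\<close> edge of a face in \<open>T\<close>; the two neighbouring edges
  on that face are glued, so the \<open>y\<close>-faces at both ends have the colour of the face in
  \<open>T\<close>.\<close>

lemma single_cycle_imp_conn:
  assumes T: "T \<subseteq> colour_class M col x" and single: "single_cycle T"
  shows "conn (nodes T) (glue T) F (\<lambda>d. F (al d))"
proof (rule connI)
  fix R u v
  assume R: "\<And>d. d \<in> glue T \<Longrightarrow> R (F d) = R (F (al d))"
    and uv: "u \<in> nodes T" "v \<in> nodes T" "R u"
  define Q where "Q d = R (F (ydart d))" for d
  have half: "Q (al d) = Q d"
    if d: "d \<in> cyc T" and "c d = y \<or> c d = x \<and> c (al d) = z" for d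
    using that(2)
  proof
    have dD: "d \<in> D" using d cyc_subset by blast
    assume "c d = y"
    then show ?thesis using dD distinct c_neq[OF dD] unfolding Q_def ydart_def by simp
  next
    have dD: "d \<in> D" using d cyc_subset by blast
    assume cd: "c d = x \<and> c (al d) = z"
    then have T: "F d \<in> T" using d distinct unfolding cyc_def by auto
    have c3: "c (sg (sg d)) = y" by (rule col_cases[OF dD]) (use cd dD distinct in auto)
    have "al (sg (sg d)) \<in> glue T" using c3 cd dD T unfolding glue_def by auto
    then have 1: "R (F (sg (sg d))) = R (F d)" using R dD by fastforce
    have "sg (al d) \<in> glue T" using c3 cd dD T unfolding glue_def by auto
    then have 2: "R (F d) = R (F (sg (sg (al d))))" using R dD by fastforce
    have "ydart d = sg (sg d)" "ydart (al d) = sg (sg (al d))"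
      using c3 cd dD distinct unfolding ydart_def by auto
    then show ?thesis using 1 2 unfolding Q_def by simp
  qed
  have QC: "Q (al d) = Q d" if d: "d \<in> cyc T" for d
  proof -
    have dD: "d \<in> D" using d cyc_subset by blast
    have "(c d = y \<or> c d = x \<and> c (al d) = z) \<or> (c (al d) = y \<or> c (al d) = x \<and> c d = z)"
      by (rule col_cases[OF dD]) (use dD distinct in auto)
    then show ?thesis
      using half[OF d] half[OF cyc_al[OF d]] dD by auto
  qed
  have const: "Q d = Q e" if "d \<in> D" "e \<in> D" for d e
    by (rule single_cycleD[OF single, of Q]) (use QC that ydart(3) in \<open>auto simp: Q_def\<close>)
  have "\<exists>d\<in>D. R w = Q d" if w: "w \<in> nodes T" for w
  proof (cases "w \<in> T")
    case False
    then obtain d where "d \<in> D" "w = F d" "c d = y"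
      using w unfolding nodes_def by (auto simp: colour_class_iff)
    then show ?thesis unfolding Q_def ydart_def by auto
  next
    case True
    then obtain d where d: "d \<in> D" "w = F d" "c d = x"
      using T colour_class_iff by blast
    \<comment> \<open>The neighbours of an \<open>x\<close>-face alternate between \<open>y\<close>
      and \<open>z\<close>, so \<open>d\<close> or the next dart of its face will do.\<close>
    obtain e where e: "e \<in> D" "w = F e" "c e = x" "c (sg e) = y"
    proof (cases "c (sg d) = y")
      case False
      then have "c (sg (sg (al d))) = y"
        using d by (auto intro: col_cases[OF d(1)] simp: distinct)
      then show thesis using that[of "sg (al d)"] d by simp
    qed (use d that in auto)
    then have "R w = R (F (sg e))" using R[of e] True unfolding glue_def by simp
    then show ?thesis using e distinct unfolding Q_def ydart_def by auto
  qed
  then show "R v" using const uv by metis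
qed

lemma finite_faces [simp]: "finite (faces M)" unfolding faces_def by simp

lemma finite_nodes: "T \<subseteq> colour_class M col x \<Longrightarrow> finite (nodes T)"
  unfolding nodes_def colour_class_def
  by (rule finite_subset[OF _ finite_faces]) blast

lemma finite_glue: "finite (glue T)" unfolding glue_def by simp

lemma face_of_eq_Collect: "d \<in> D \<Longrightarrow> F d = {e \<in> D. F e = F d}"
  using F_mem[of d] by blast

lemma sum_telescope_face:
  fixes w :: "'d \<Rightarrow> int"
  assumes "d \<in> D" shows "(\<Sum>e | e \<in> D \<and> F e = F d. w e - w (sg (al e))) = 0"
  using sum_telescope_orb[OF finite_D bij_phi assms, of w] face_of_eq_Collect[OF assms]
  by (simp add: face_of_def phi_eq)

text \<open>An edge on the boundary of a node either separates the two regions, and is in the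
  2-factor, or has nodes on both sides, and is glued.\<close>

lemma node_dart_cases:
  assumes "e \<in> D" "F e \<in> nodes T" "T \<subseteq> colour_class M col x"
  shows "e \<in> cyc T \<or> e \<in> glue T \<or> al e \<in> glue T"
proof (rule col_cases[OF assms(1)])
  assume "c e = x"
  then have "F e \<in> T" using assms(2) distinct unfolding nodes_def colour_class_def by auto
  then show ?thesis
    by (rule_tac col_cases[OF assms(1)]) (use assms(1) \<open>c e = x\<close> distinct in \<open>auto simp: cyc_def glue_def\<close>)
next
  assume "c e = x"
  then have "F e \<in> T" using assms(2) distinct unfolding nodes_def colour_class_def by auto
  then show ?thesis
    by (rule_tac col_cases[OF assms(1)]) (use assms(1) \<open>c e = x\<close> distinct in \<open>auto simp: cyc_def glue_def\<close>)
next
  assume "c e = z"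
  then show ?thesis
    using assms(2,3) distinct unfolding nodes_def colour_class_def by auto
next
  assume "c e = z"
  then show ?thesis
    using assms(2,3) distinct unfolding nodes_def colour_class_def by auto
qed (use assms(1) distinct in \<open>auto simp: cyc_def glue_def\<close>)

text \<open>A vertex set invariant under the 2-factor induces a circulation on the graph of glued faces:
going around a face, the boundary enters the set as often as it leaves it. A tree carries no
nonzero circulation.\<close>

lemma tree_imp_single_cycle:
  assumes T: "T \<subseteq> colour_class M col x"
    and conn: "conn (nodes T) (glue T) F (\<lambda>d. F (al d))"
    and bridge: "\<And>e. e \<in> glue T \<Longrightarrow> \<not> conn (nodes T) (glue T - {e}) F (\<lambda>d. F (al d))"
  shows "single_cycle T"
proof (rule single_cycleI)
  fix Q :: "'d \<Rightarrow> bool" and d e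
  assume Qs: "\<And>d. d \<in> D \<Longrightarrow> Q (sg d) = Q d" and Qc: "\<And>d. d \<in> cyc T \<Longrightarrow> Q (al d) = Q d"
    and de: "d \<in> D" "e \<in> D"
  define w :: "'d \<Rightarrow> int" where "w d = of_bool (Q d) - of_bool (Q (al d))" for d
  have w_al: "w (al d) = - w d" if "d \<in> D" for d using that unfolding w_def by simp
  have w_cyc: "w d = 0" if "d \<in> cyc T" for d using Qc[OF that] unfolding w_def by simp
  have w_face: "(\<Sum>e | e \<in> D \<and> F e = F d. w e) = 0" if "d \<in> D" for d
  proof -
    have "(\<Sum>e | e \<in> D \<and> F e = F d. w e)
        = (\<Sum>e | e \<in> D \<and> F e = F d. of_bool (Q e) - of_bool (Q (sg (al e))))"
      by (rule sum.cong) (use Qs in \<open>auto simp: w_def\<close>)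
    then show ?thesis using sum_telescope_face[OF that, of "\<lambda>e. of_bool (Q e)"] by simp
  qed
  \<comment> \<open>An \<open>x\<close>-node is only a source and a \<open>y\<close>-node only a
    target of glued darts. So one of the two sums is empty, and the other is, up to sign, the sum of
    \<open>w\<close> around the whole face, because \<open>w\<close> vanishes on the
    2-factor.\<close>
  have cons: "(\<Sum>i | i \<in> glue T \<and> F i = v. w i) = (\<Sum>i | i \<in> glue T \<and> F (al i) = v. w i)"
    if v: "v \<in> nodes T" for v
  proof -
    have "v \<in> colour_class M col x \<or> v \<in> colour_class M col y"
      using v T unfolding nodes_def by blast
    then obtain d where d: "d \<in> D" "v = F d" by (auto simp: colour_class_iff)
    have nc: "e \<in> glue T \<or> al e \<in> glue T" if "e \<in> D" "F e = v" "w e \<noteq> 0" for e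
      using node_dart_cases[OF that(1) _ T] w_cyc that v by blast
    show ?thesis
    proof (cases "col v = x")
      case True
      have "(\<Sum>i | i \<in> glue T \<and> F i = v. w i) = (\<Sum>e | e \<in> D \<and> F e = v. w e)"
      proof (rule sum.mono_neutral_left)
        show "\<forall>i\<in>{e \<in> D. F e = v} - {i \<in> glue T. F i = v}. w i = 0"
          using nc True distinct unfolding glue_def by fastforce
      qed (auto simp: glue_def)
      also have "\<dots> = 0" using w_face d by simp
      finally have 1: "(\<Sum>i | i \<in> glue T \<and> F i = v. w i) = 0" .
      have 2: "{i. i \<in> glue T \<and> F (al i) = v} = {}"
        using True distinct unfolding glue_def by auto
      show ?thesis unfolding 1 2 by simp
    next
      case False
      have 1: "{i. i \<in> glue T \<and> F i = v} = {}"
        using False unfolding glue_def by auto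
      have "(\<Sum>i | i \<in> glue T \<and> F (al i) = v. w i)
          = (\<Sum>e | al e \<in> glue T \<and> e \<in> D \<and> F e = v. - w e)"
        by (rule sum.reindex_bij_witness[of _ al al]) (auto simp: glue_def w_al)
      also have "\<dots> = (\<Sum>e | e \<in> D \<and> F e = v. - w e)"
      proof (rule sum.mono_neutral_left)
        show "\<forall>i\<in>{e \<in> D. F e = v} - {e. al e \<in> glue T \<and> e \<in> D \<and> F e = v}. - w i = 0"
          using nc False unfolding glue_def by fastforce
      qed auto
      also have "\<dots> = 0" using w_face d by (simp add: sum_negf)
      finally show ?thesis unfolding 1 by simp
    qed
  qed
  have w0: "w i = 0" if "i \<in> glue T" for i
    by (rule circulation_on_bridge[where s = F and t = "\<lambda>d. F (al d)",
          OF finite_nodes[OF T] finite_glue glue_ends conn that bridge[OF that] cons])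
  have Qg: "Q (al i) = Q i" if "i \<in> glue T" for i
    using w0[OF that] unfolding w_def by (auto split: if_splits)
  have Qn: "Q (al e) = Q e" if "e \<in> D" "F e \<in> nodes T" for e
    using node_dart_cases[OF that T] Qc[of e] Qg[of e] Qg[of "al e"] that(1) by auto
  have Qf: "Q e = Q d" if "d \<in> D" "F d \<in> nodes T" "e \<in> F d" for d e
    by (rule F_induct[OF that(1,3)]) (use Qn Qs that(2) in auto)
  \<comment> \<open>\<open>Q\<close> is now also constant across glued edges, hence around every
    node, and descends to a colouring of the nodes. Since each vertex lies on a
    \<open>y\<close>-face, this colouring determines \<open>Q\<close>.\<close>
  define R where "R f = (\<exists>e\<in>f. Q e)" for f
  have R: "R (F d) = Q d" if "d \<in> D" "F d \<in> nodes T" for d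
    using Qf[OF that] F_mem[OF that(1), of d] that(1) unfolding R_def by blast
  have Rg: "R (F i) = R (F (al i))" if "i \<in> glue T" for i
  proof -
    have "i \<in> D" using that unfolding glue_def by blast
    then show ?thesis using R[of i] R[of "al i"] glue_ends[OF that] Qg[OF that] by simp
  qed
  have y: "Q d = R (F (ydart d))" "F (ydart d) \<in> nodes T" if "d \<in> D" for d
  proof -
    show "F (ydart d) \<in> nodes T"
      using ydart[OF that] unfolding nodes_def colour_class_def by simp
    moreover have "Q (ydart d) = Q d" unfolding ydart_def using Qs that by auto
    ultimately show "Q d = R (F (ydart d))" using R[OF ydart(1)[OF that]] by simp
  qed
  show "Q d = Q e"
    unfolding y(1)[OF de(1)] y(1)[OF de(2)]
    by (rule connD[OF conn, of R]) (use Rg y(2) de in auto)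
qed

subsection \<open>Consequences of Euler's formula\<close>

definition between :: "nat \<Rightarrow> nat \<Rightarrow> 'd set" where
  "between a b = {d \<in> D. c d = a \<and> c (al d) = b}"

lemma finite_between [simp]: "finite (between a b)" unfolding between_def by simp

lemma card_between_rotate:
  assumes "\<And>d. d \<in> D \<Longrightarrow> c d = a \<Longrightarrow> c (sg d) = b \<Longrightarrow> c (sg (sg d)) = k"
    and "\<And>d. d \<in> D \<Longrightarrow> c d = b \<Longrightarrow> c (sg d) = k \<Longrightarrow> c (sg (sg d)) = a"
  shows "card (between a b) = card (between b k)"
proof -
  have "bij_betw sg (between a b) (between b k)"
    by (rule bij_betw_byWitness[where f' = "\<lambda>d. sg (sg d)"])
      (use assms in \<open>auto simp: between_def\<close>)
  then show ?thesis by (rule bij_betw_same_card)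
qed

text \<open>All three numbers count the vertices at which \<open>x\<close>, \<open>y\<close>,
  \<open>z\<close> occur in the order of the rotation: such a vertex has one dart of each kind, and
  the other vertices have none.\<close>

lemma card_between_cyclic:
  "card (between y z) = card (between x y)" "card (between z x) = card (between x y)"
proof -
  have "card (between x y) = card (between y z)"
    by (rule card_between_rotate; erule col_cases; use distinct in simp)
  moreover have "card (between y z) = card (between z x)"
    by (rule card_between_rotate; erule col_cases; use distinct in simp)
  ultimately show "card (between y z) = card (between x y)" "card (between z x) = card (between x y)"
    by simp_all
qed

lemma card_between_swap: "card (between a b) = card (between b a)"
proof -
  have "bij_betw al (between a b) (between b a)"
    by (rule bij_betw_byWitness[where f' = al]) (auto simp: between_def)
  then show ?thesis by (rule bij_betw_same_card)
qed

text \<open>One dart of each edge.\<close>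

definition pos :: "'d set" where
  "pos = between x y \<union> between y z \<union> between z x"

lemma pos_subset: "pos \<subseteq> D" unfolding pos_def between_def by blast

lemma finite_pos [simp]: "finite pos" unfolding pos_def by simp

lemma pos_al: "d \<in> D \<Longrightarrow> al d \<in> pos \<longleftrightarrow> d \<notin> pos"
  by (rule col_cases[of d]) (use distinct in \<open>auto simp: pos_def between_def\<close>)

lemma card_pos: "card pos = 3 * card (between x y)"
proof -
  have "card pos = card (between x y \<union> between y z) + card (between z x)"
    unfolding pos_def by (rule card_Un_disjoint) (use distinct in \<open>auto simp: between_def\<close>)
  also have "card (between x y \<union> between y z) = card (between x y) + card (between y z)"
    by (rule card_Un_disjoint) (use distinct in \<open>auto simp: between_def\<close>)
  finally show ?thesis using card_between_cyclic by simp
qed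

lemma edge_of_eq: "d \<in> D \<Longrightarrow> edge_of M d = {d, al d}"
proof
  assume d: "d \<in> D"
  show "edge_of M d \<subseteq> {d, al d}"
  proof
    fix e assume "e \<in> edge_of M d"
    then have "e \<in> orb al d" unfolding edge_of_def .
    then show "e \<in> {d, al d}" by (induction rule: orb_induct) (use d in auto)
  qed
qed (auto simp: edge_of_def orb_self intro: orb_step)

lemma card_edges: "card (edges M) = 3 * card (between x y)"
proof -
  have "bij_betw (edge_of M) pos (edges M)"
  proof (rule bij_betw_imageI)
    show "inj_on (edge_of M) pos"
    proof (rule inj_onI)
      fix d e assume de: "d \<in> pos" "e \<in> pos" "edge_of M d = edge_of M e"
      then have D: "d \<in> D" "e \<in> D" using pos_subset by auto
      then have "d = e \<or> d = al e" using de(3) by (auto simp: edge_of_eq doubleton_eq_iff)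
      then show "d = e" using pos_al de D by auto
    qed
    show "edge_of M ` pos = edges M"
    proof
      show "edge_of M ` pos \<subseteq> edges M" using pos_subset unfolding edges_def by blast
      show "edges M \<subseteq> edge_of M ` pos"
      proof
        fix f assume "f \<in> edges M"
        then obtain d where d: "d \<in> D" "f = edge_of M d" unfolding edges_def by blast
        then have "edge_of M (al d) = f" by (auto simp: edge_of_eq)
        then show "f \<in> edge_of M ` pos" using d pos_al[OF d(1)] by blast
      qed
    qed
  qed
  then show ?thesis using card_pos by (simp add: bij_betw_same_card)
qed

text \<open>Each vertex has one dart on an \<open>x\<close>-\<open>y\<close> edge. Whether it lies
  in \<open>between x y\<close> or in \<open>between y x\<close> depends on the cyclic order of the
  colours at the vertex.\<close>

lemma card_verts: "card (verts M) = 2 * card (between x y)"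
proof -
  have "bij_betw (vert_of M) (between x y \<union> between y x) (verts M)"
  proof (rule bij_betw_imageI)
    show "inj_on (vert_of M) (between x y \<union> between y x)"
    proof (rule inj_onI)
      fix d e assume de: "d \<in> between x y \<union> between y x" "e \<in> between x y \<union> between y x"
        "vert_of M d = vert_of M e"
      then have D: "d \<in> D" "e \<in> D" unfolding between_def by auto
      then have "d = e \<or> d = sg e \<or> d = sg (sg e)" using vert_of_eq[of e] vert_of_eq[of d] de(3) by blast
      moreover have "d \<noteq> sg e" "d \<noteq> sg (sg e)"
        by (rule col_cases[OF D(2)]; use de(1,2) D distinct in \<open>auto simp: between_def\<close>)+
      ultimately show "d = e" by blast
    qed
    show "vert_of M ` (between x y \<union> between y x) = verts M"
    proof
      show "vert_of M ` (between x y \<union> between y x) \<subseteq> verts M"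
        unfolding verts_def between_def by blast
      show "verts M \<subseteq> vert_of M ` (between x y \<union> between y x)"
      proof
        fix v assume "v \<in> verts M"
        then obtain d where d: "d \<in> D" "v = vert_of M d" unfolding verts_def by blast
        have "\<exists>e\<in>{d, sg d, sg (sg d)}. e \<in> between x y \<union> between y x"
          by (rule col_cases[OF d(1)]) (use d in \<open>auto simp: between_def\<close>)
        moreover have "vert_of M e = v" if "e \<in> {d, sg d, sg (sg d)}" for e
          using that d by auto
        ultimately show "v \<in> vert_of M ` (between x y \<union> between y x)" by blast
      qed
    qed
  qed
  then have "card (verts M) = card (between x y \<union> between y x)"
    by (simp add: bij_betw_same_card)
  also have "\<dots> = card (between x y) + card (between y x)"
    by (rule card_Un_disjoint) (use distinct in \<open>auto simp: between_def\<close>)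
  finally show ?thesis using card_between_swap[of x y] by simp
qed

lemma card_faces: "card (faces M) = card (between x y) + 2"
  using plane card_verts card_edges unfolding plane_map_def by simp

lemma swap_colours: "coloured_cubic_map M col x z y"
proof
  show "col f \<in> {x, z, y}" if "f \<in> faces M" for f using colours[OF that] by blast
  show "x \<noteq> z" "z \<noteq> y" "x \<noteq> y" using distinct by auto
qed (rule plane simple three_conn cubic proper; assumption?)+

text \<open>The two regions change places, and their common boundary stays the same.\<close>

lemma swap_cyc:
  "coloured_cubic_map.cyc M col x y (colour_class M col x - T) = cyc T"
proof -
  interpret sw: coloured_cubic_map M col x z y by (rule swap_colours)
  have "d \<in> sw.cyc (colour_class M col x - T) \<longleftrightarrow> d \<in> cyc T" if d: "d \<in> D" for d
    by (rule col_cases[OF d])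
      (use d distinct in \<open>simp_all add: cyc_def sw.cyc_def colour_class_def\<close>)
  then show ?thesis using cyc_subset sw.cyc_subset by blast
qed

lemma swap_single_cycle:
  "coloured_cubic_map.single_cycle M col x y (colour_class M col x - T) \<longleftrightarrow> single_cycle T"
proof -
  interpret sw: coloured_cubic_map M col x z y by (rule swap_colours)
  show ?thesis unfolding single_cycle_def sw.single_cycle_def swap_cyc ..
qed

text \<open>Let n be \<open>card (between x y)\<close>. The graphs of both regions are connected, so
  each has at most one node more than edges. Together they have n + 2 nodes, namely all faces, and n
  edges, so equality holds in both.\<close>

lemma single_cycle_card:
  assumes T: "T \<subseteq> colour_class M col x" and single: "single_cycle T"
  shows "card (glue T) + 1 = card (nodes T)"
proof -
  interpret sw: coloured_cubic_map M col x z y by (rule swap_colours)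
  define U where "U = colour_class M col x - T"
  have U: "U \<subseteq> colour_class M col x" "sw.single_cycle U"
    using single swap_single_cycle unfolding U_def by auto
  have "card (nodes T) \<le> card (glue T) + 1"
    by (rule conn_card_le[OF finite_nodes[OF T] finite_glue glue_ends
          single_cycle_imp_conn[OF T single]])
  moreover have "card (sw.nodes U) \<le> card (sw.glue U) + 1"
    by (rule conn_card_le[OF sw.finite_nodes[OF U(1)] sw.finite_glue sw.glue_ends
          sw.single_cycle_imp_conn[OF U]])
  moreover have "card (nodes T) + card (sw.nodes U) = card (faces M)"
  proof -
    have "nodes T \<union> sw.nodes U = faces M"
      using T colours unfolding U_def nodes_def sw.nodes_def colour_class_def by blast
    moreover have "nodes T \<inter> sw.nodes U = {}"
      using T distinct unfolding U_def nodes_def sw.nodes_def colour_class_def by blast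
    ultimately show ?thesis
      using card_Un_disjoint[OF finite_nodes[OF T] sw.finite_nodes[OF U(1)]] by simp
  qed
  moreover have "card (glue T) + card (sw.glue U) = card (between x y)"
  proof -
    have third: "c (sg (sg d)) = z" if "d \<in> D" "c d = x" "c (sg d) = y" for d
      by (rule col_cases[OF that(1)]) (use that distinct in auto)
    have third': "c (sg (sg d)) = y" if "d \<in> D" "c d = x" "c (sg d) = z" for d
      by (rule col_cases[OF that(1)]) (use that distinct in auto)
    \<comment> \<open>One step along an \<open>x\<close>-face leads from an
      \<open>x\<close>-\<open>z\<close> edge to an \<open>x\<close>-\<open>y\<close> edge of the
      same face. So the outer region has as many glued edges as there are
      \<open>x\<close>-\<open>y\<close> edges on faces outside \<open>T\<close>.\<close>
    have "bij_betw (\<lambda>d. sg (al d)) (sw.glue U) (between x y - glue T)"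
    proof (rule bij_betw_byWitness[where f' = "\<lambda>d. al (sg (sg d))"])
      show "(\<lambda>d. sg (al d)) ` sw.glue U \<subseteq> between x y - glue T"
      proof
        fix e assume "e \<in> (\<lambda>d. sg (al d)) ` sw.glue U"
        then obtain d where e: "d \<in> sw.glue U" "e = sg (al d)" by blast
        then have e': "d \<in> D" "c d = x" "c (al d) = z" "F d \<notin> T" "e = sg (al d)"
          unfolding sw.glue_def U_def by blast+
        then have d: "d \<in> D" "c d = x" "c (sg d) = z" by simp_all
        show "e \<in> between x y - glue T"
          using third'[OF d] d e' by (simp add: glue_def between_def)
      qed
      show "(\<lambda>d. al (sg (sg d))) ` (between x y - glue T) \<subseteq> sw.glue U"
      proof
        fix e assume "e \<in> (\<lambda>d. al (sg (sg d))) ` (between x y - glue T)"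
        then obtain d where e: "d \<in> between x y - glue T" "e = al (sg (sg d))" by blast
        then have e': "d \<in> D" "c d = x" "c (al d) = y" "F d \<notin> T" "e = al (sg (sg d))"
          unfolding between_def glue_def by blast+
        then have d: "d \<in> D" "c d = x" "c (sg d) = y" by simp_all
        show "e \<in> sw.glue U"
          using third[OF d] d e' by (simp add: sw.glue_def U_def colour_class_def)
      qed
      show "\<forall>d\<in>sw.glue U. al (sg (sg (sg (al d)))) = d" by (simp add: sw.glue_def)
      show "\<forall>d\<in>between x y - glue T. sg (al (al (sg (sg d)))) = d" by (simp add: between_def)
    qed
    then have "card (sw.glue U) = card (between x y - glue T)" by (rule bij_betw_same_card)
    moreover have "glue T \<subseteq> between x y" unfolding glue_def between_def by blast
    ultimately show ?thesis
      by (simp add: card_Diff_subset finite_glue card_mono)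
  qed
  ultimately show ?thesis using card_faces by linarith
qed

subsection \<open>Two faces share at most one edge\<close>

lemma vert_in_verts [simp]: "d \<in> D \<Longrightarrow> vert_of M d \<in> verts M" unfolding verts_def by blast

lemma finite_verts: "finite (verts M)" unfolding verts_def by simp

lemma sum_telescope_vert:
  fixes w :: "'d \<Rightarrow> int"
  assumes "d \<in> D" shows "(\<Sum>e | e \<in> D \<and> vert_of M e = vert_of M d. w e - w (sg e)) = 0"
proof -
  have "orb sg d = {e \<in> D. vert_of M e = vert_of M d}"
    using vert_of_mem[OF assms] unfolding vert_of_def by blast
  then show ?thesis using sum_telescope_orb[OF finite_D bij_sg assms, of w] by simp
qed

text \<open>A union of components of the cotree would define a circulation on the spanning tree.\<close>

lemma cotree_conn:
  assumes J: "J \<subseteq> pos" and conn: "conn (verts M) J (vert_of M) (\<lambda>d. vert_of M (al d))"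
    and card: "card J + 1 = card (verts M)"
  shows "conn (faces M) (pos - J) F (\<lambda>d. F (al d))"
proof (rule connI)
  fix R u v
  assume R: "\<And>d. d \<in> pos - J \<Longrightarrow> R (F d) = R (F (al d))"
    and uv: "u \<in> faces M" "v \<in> faces M" "R u"
  define w :: "'d \<Rightarrow> int" where "w d = of_bool (R (F d)) - of_bool (R (F (al d)))" for d
  have w_al: "w (al d) = - w d" if "d \<in> D" for d using that unfolding w_def by simp
  have JD: "J \<subseteq> D" using J pos_subset by blast
  have fJ: "finite J" using J finite_subset finite_pos by blast
  have ends: "vert_of M i \<in> verts M" "vert_of M (al i) \<in> verts M" if "i \<in> J" for i
    using that JD by auto
  have w0: "w i = 0" if "i \<in> pos - J" for i using R[OF that] unfolding w_def by simp
  have cons: "(\<Sum>i | i \<in> J \<and> vert_of M i = v. w i) = (\<Sum>i | i \<in> J \<and> vert_of M (al i) = v. w i)"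
    if "v \<in> verts M" for v
  proof -
    obtain d where d: "d \<in> D" "v = vert_of M d" using \<open>v \<in> verts M\<close> unfolding verts_def by blast
    have 1: "(\<Sum>i | i \<in> J \<and> vert_of M i = v. w i) = (\<Sum>i | i \<in> pos \<and> vert_of M i = v. w i)"
      by (rule sum.mono_neutral_left) (use J w0 in auto)
    have "(\<Sum>i | i \<in> J \<and> vert_of M (al i) = v. w i) = (\<Sum>i | i \<in> pos \<and> vert_of M (al i) = v. w i)"
      by (rule sum.mono_neutral_left) (use J w0 in auto)
    also have "\<dots> = (\<Sum>e | e \<in> D - pos \<and> vert_of M e = v. - w e)"
      by (rule sum.reindex_bij_witness[of _ al al])
        (use pos_subset pos_al w_al in \<open>auto dest: subsetD[OF pos_subset]\<close>)
    finally have 2: "(\<Sum>i | i \<in> J \<and> vert_of M (al i) = v. w i)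
        = - (\<Sum>e | e \<in> D - pos \<and> vert_of M e = v. w e)" by (simp add: sum_negf)
    have "(\<Sum>e | e \<in> D \<and> vert_of M e = v. w e)
        = (\<Sum>e | e \<in> D \<and> vert_of M e = v. of_bool (R (F e)) - of_bool (R (F (sg e))))"
      by (rule sum.cong) (auto simp: w_def)
    also have "\<dots> = 0"
      unfolding d(2) by (rule sum_telescope_vert[OF d(1), of "\<lambda>e. of_bool (R (F e))"])
    finally have 3: "(\<Sum>e | e \<in> D \<and> vert_of M e = v. w e) = 0" .
    have "{e. e \<in> D \<and> vert_of M e = v}
        = {i. i \<in> pos \<and> vert_of M i = v} \<union> {e. e \<in> D - pos \<and> vert_of M e = v}"
      using pos_subset by blast
    then have "(\<Sum>e | e \<in> D \<and> vert_of M e = v. w e)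
        = (\<Sum>i | i \<in> pos \<and> vert_of M i = v. w i) + (\<Sum>e | e \<in> D - pos \<and> vert_of M e = v. w e)"
      by (simp only:) (rule sum.union_disjoint; auto)
    then show ?thesis using 1 2 3 by simp
  qed
  have "w i = 0" if "i \<in> J" for i
    by (rule circulation_on_bridge[where s = "vert_of M" and t = "\<lambda>d. vert_of M (al d)",
          OF finite_verts fJ ends conn that
             tree_edge_is_bridge[where s = "vert_of M" and t = "\<lambda>d. vert_of M (al d)",
               OF finite_verts fJ ends card that] cons])
  then have wpos: "w i = 0" if "i \<in> pos" for i using w0 that by blast
  have Ral: "R (F (al d)) = R (F d)" if "d \<in> D" for d
  proof -
    have "w d = 0 \<or> w (al d) = 0" using wpos pos_al[OF that] by blast
    then have "w d = 0" using w_al[OF that] by simp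
    then show ?thesis unfolding w_def by (simp split: if_splits add: of_bool_eq_iff)
  qed
  obtain d e where de: "d \<in> D" "e \<in> D" "u = F d" "v = F e" using uv unfolding faces_def by blast
  have "R (F d) = R (F e)"
    by (rule map_conn[where Q = "\<lambda>d. R (F d)"]) (use Ral de in auto)
  then show "R v" using uv de by simp
qed

text \<open>If some spanning tree avoided both edges, its cotree would contain both. They are
  parallel in the dual graph, so one of them could be dropped, and n edges would connect n + 2
  faces, where n is \<open>card (between x y)\<close>.\<close>

lemma parallel_not_conn:
  assumes de: "d \<in> pos" "e \<in> pos" "d \<noteq> e" "F d = F e" "F (al d) = F (al e)"
  shows "\<not> conn (verts M) (pos - {d, e}) (vert_of M) (\<lambda>d. vert_of M (al d))"
proof
  assume conn: "conn (verts M) (pos - {d, e}) (vert_of M) (\<lambda>d. vert_of M (al d))"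
  have ne: "verts M \<noteq> {}" using D_nonempty unfolding verts_def by blast
  have fin: "finite (pos - {d, e})" by simp
  have ends: "vert_of M i \<in> verts M" "vert_of M (al i) \<in> verts M" if "i \<in> pos - {d, e}" for i
    using that pos_subset by auto
  obtain J where J: "J \<subseteq> pos - {d, e}" "conn (verts M) J (vert_of M) (\<lambda>d. vert_of M (al d))"
    "card J + 1 = card (verts M)"
    by (rule spanning_tree_exists[where s = "vert_of M" and t = "\<lambda>d. vert_of M (al d)",
          OF finite_verts fin ne ends conn])
  have J': "J \<subseteq> pos" using J(1) by blast
  have "conn (faces M) (pos - J - {e}) F (\<lambda>d. F (al d))"
  proof (rule connI)
    fix R u v
    assume R: "\<And>i. i \<in> pos - J - {e} \<Longrightarrow> R (F i) = R (F (al i))"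
      and uv: "u \<in> faces M" "v \<in> faces M" "R u"
    have "R (F i) = R (F (al i))" if "i \<in> pos - J" for i
    proof (cases "i = e")
      case True
      have "d \<in> pos - J - {e}" using J(1) de by blast
      from R[OF this] show ?thesis using True de(4,5) by simp
    qed (use R that in blast)
    then show "R v" using connD[OF cotree_conn[OF J' J(2,3)], of R u v] uv by blast
  qed
  then have "card (faces M) \<le> card (pos - J - {e}) + 1"
    by (rule conn_card_le[rotated 4]) (auto dest: subsetD[OF pos_subset])
  moreover have "card (pos - J - {e}) = card pos - card J - 1"
  proof -
    have "finite J" using J' finite_subset finite_pos by blast
    moreover have "e \<in> pos - J" using J(1) de by blast
    ultimately show ?thesis using J' by (simp add: card_Diff_subset)
  qed
  ultimately show False using card_faces card_pos card_verts J(3) by linarith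
qed

text \<open>Otherwise the two edges contain an edge cut. Delete one vertex on each side of it,
  chosen so that every edge of the cut loses an end. By 3-connectivity the rest stays connected,
  which is impossible if each side still has a vertex.\<close>

lemma parallel_eq:
  assumes de: "d \<in> between x y" "e \<in> between x y" "F d = F e" "F (al d) = F (al e)"
  shows "d = e"
proof (rule ccontr)
  assume ne: "d \<noteq> e"
  have dD: "d \<in> D" "e \<in> D" using de unfolding between_def by auto
  have "\<not> conn (verts M) (pos - {d, e}) (vert_of M) (\<lambda>d. vert_of M (al d))"
    by (rule parallel_not_conn) (use de ne in \<open>auto simp: pos_def\<close>)
  then obtain Q :: "'d set \<Rightarrow> bool" and u v
    where Q: "\<And>i. i \<in> pos - {d, e} \<Longrightarrow> Q (vert_of M i) = Q (vert_of M (al i))"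
      and uv: "u \<in> verts M" "v \<in> verts M" "Q u \<noteq> Q v"
    unfolding conn_def by blast
  define cross where "cross i \<longleftrightarrow> i \<in> D \<and> Q (vert_of M i) \<noteq> Q (vert_of M (al i))" for i
  have cross_al: "cross (al i)" if "cross i" for i using that unfolding cross_def by auto
  have cross_in: "i \<in> {d, al d, e, al e}" if "cross i" for i
  proof -
    have i: "i \<in> D" using that unfolding cross_def by blast
    show ?thesis
    proof (cases "i \<in> pos")
      case True
      then show ?thesis using Q[of i] that unfolding cross_def by blast
    next
      case False
      then have "al i \<in> pos" using pos_al[OF i] by blast
      then have "al i \<in> {d, e}" using Q[of "al i"] cross_al[OF that] unfolding cross_def by blast
      then show ?thesis using al_al[OF i] by fastforce
    qed
  qed
  have xy_third: "c (sg (sg m)) = z" if "m \<in> between x y" for m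
  proof -
    have m: "m \<in> D" "c m = x" "c (sg m) = y" using that F_al unfolding between_def by auto
    show ?thesis by (rule col_cases[OF m(1)]) (use m distinct in simp_all)
  qed
  have third: "c (sg (sg m)) = z" if "m \<in> {d, al d, e, al e}" for m
    using that xy_third[OF de(1)] xy_third[OF de(2)] dD by auto
  \<comment> \<open>Both edges are \<open>x\<close>-\<open>y\<close> edges, so the next edge at an
    end of either of them borders a \<open>z\<close>-face and is not in the cut. Its other end is a
    second vertex on the same side.\<close>
  have nbr: "\<exists>a\<in>verts M. a \<noteq> vert_of M i \<and> Q a = Q (vert_of M i)" if "cross i" for i
  proof -
    have i: "i \<in> D" using that unfolding cross_def by blast
    have "sg i \<notin> {d, al d, e, al e}"
    proof
      assume "sg i \<in> {d, al d, e, al e}"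
      then have "c (sg (sg (sg i))) = c (sg (sg i))"
        using third[of "sg i"] third[OF cross_in[OF that]] by simp
      then show False using c_neq[of "sg (sg i)"] i by simp
    qed
    then have "\<not> cross (sg i)" using cross_in by blast
    then have "Q (vert_of M (al (sg i))) = Q (vert_of M i)" using i unfolding cross_def by simp
    moreover have "vert_of M (al (sg i)) \<noteq> vert_of M (sg i)"
      using simple i sg_in unfolding simple_map_def by blast
    ultimately show ?thesis using i by (intro bexI[of _ "vert_of M (al (sg i))"]) auto
  qed
  have key: False if k: "cross k" "Q (vert_of M k)" and l: "cross l" "\<not> Q (vert_of M l)"
    and all: "\<And>m. cross m \<Longrightarrow> m \<in> {k, al k, l, al l}" for k l
  proof -
    have D: "k \<in> D" "l \<in> D" using k l unfolding cross_def by auto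
    define S where "S = {vert_of M k, vert_of M l}"
    obtain a where a: "a \<in> verts M" "a \<noteq> vert_of M k" "Q a" using nbr[OF k(1)] k(2) by blast
    obtain b where b: "b \<in> verts M" "b \<noteq> vert_of M l" "\<not> Q b" using nbr[OF l(1)] l(2) by blast
    have S: "S \<subseteq> verts M" "card S < 3" using D unfolding S_def by (auto simp: card_insert_if)
    have ab: "a \<in> verts M - S" "b \<in> verts M - S" using a b k(2) l(2) unfolding S_def by auto
    have "(a, b) \<in> (adj_rel M \<inter> ((verts M - S) \<times> (verts M - S)))\<^sup>*"
      using three_conn S ab unfolding three_connected_def by blast
    then have "Q b"
    proof (induction rule: rtrancl_induct)
      case (step p q)
      then obtain m where m: "m \<in> D" "p = vert_of M m" "q = vert_of M (al m)"
        unfolding adj_rel_def by blast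
      have "\<not> cross m"
      proof
        assume "cross m"
        then have "m \<in> {k, al k, l, al l}" by (rule all)
        then have "p \<in> S \<or> q \<in> S" using m D unfolding S_def by auto
        then show False using step(2) by blast
      qed
      then show ?case using step(3) m unfolding cross_def by blast
    qed (rule a(3))
    then show False using b by blast
  qed
  have ends: "\<exists>k\<in>{i, al i}. cross k \<and> Q (vert_of M k)"
    "\<exists>k\<in>{i, al i}. cross k \<and> \<not> Q (vert_of M k)" if "cross i" for i
    using that cross_al[OF that] unfolding cross_def by auto
  \<comment> \<open>The colouring may change along just one of the two edges; then the two ends of
    that edge are deleted.\<close>
  have only: False if ci: "cross i" and all: "\<And>m. cross m \<Longrightarrow> m \<in> {i, al i}" for i
  proof -
    have i: "i \<in> D" using ci unfolding cross_def by blast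
    obtain k where k: "k \<in> {i, al i}" "cross k" "Q (vert_of M k)" using ends(1)[OF ci] by blast
    obtain l where l: "l \<in> {i, al i}" "cross l" "\<not> Q (vert_of M l)" using ends(2)[OF ci] by blast
    have "{i, al i} \<subseteq> {k, al k, l, al l}" using k(1) i by auto
    then show False using key[OF k(2,3) l(2,3)] all by blast
  qed
  have "cross d \<or> cross e"
  proof (rule ccontr)
    assume "\<not> (cross d \<or> cross e)"
    then have no: "\<not> cross i" for i using cross_in cross_al al_al dD by (metis insertE singletonD)
    obtain i j where ij: "i \<in> D" "j \<in> D" "u = vert_of M i" "v = vert_of M j"
      using uv unfolding verts_def by blast
    have Qal: "Q (vert_of M (al i)) = Q (vert_of M i)" if "i \<in> D" for i
      using no[of i] that unfolding cross_def by blast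
    have "Q (vert_of M i) = Q (vert_of M j)"
      by (rule map_conn[where Q = "\<lambda>i. Q (vert_of M i)", OF _ Qal ij(1,2)]) simp
    then show False using uv(3) ij by simp
  qed
  then show False
  proof (cases "cross d \<and> cross e")
    case True
    obtain k where k: "k \<in> {d, al d}" "cross k" "Q (vert_of M k)" using ends(1) True by blast
    obtain l where l: "l \<in> {e, al e}" "cross l" "\<not> Q (vert_of M l)" using ends(2) True by blast
    have "{d, al d, e, al e} \<subseteq> {k, al k, l, al l}" using k(1) l(1) dD by auto
    then show False using key[OF k(2,3) l(2,3)] cross_in by blast
  next
    case False
    assume "cross d \<or> cross e"
    moreover have "m \<in> {d, al d}" if "cross m" "\<not> cross e" for m
      using cross_in[OF that(1)] that cross_al[OF that(1)] al_al dD by auto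
    moreover have "m \<in> {e, al e}" if "cross m" "\<not> cross d" for m
      using cross_in[OF that(1)] that cross_al[OF that(1)] al_al dD by auto
    ultimately show False using only[of d] only[of e] False by blast
  qed
qed

subsection \<open>Reduced graphs\<close>

abbreviation red where "red k \<equiv> reduced_graph M col k"

definition Dred :: "nat \<Rightarrow> 'd set" where
  "Dred k = {d \<in> D. c d \<noteq> k \<and> c (sg d) \<noteq> k}"

lemma Dred_subset: "Dred k \<subseteq> D" unfolding Dred_def by blast

lemma darts_red [simp]: "cm_darts (red k) = Dred k"
  unfolding reduced_graph_def contract_faces_def Dred_def colour_class_def by auto

lemma al_red [simp]: "cm_alpha (red k) = al"
  unfolding reduced_graph_def contract_faces_def by simp

lemma sg_red [simp]: "cm_sigma (red k) d = sg (al (sg d))"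
  unfolding reduced_graph_def contract_faces_def by simp

lemma phi_red [simp]: "cm_phi (red k) d = sg (al (sg (al d)))"
  unfolding cm_phi_def by simp

lemma finite_Dred [simp]: "finite (Dred k)" unfolding Dred_def by simp

lemma Dred_al [simp]: "d \<in> Dred k \<Longrightarrow> al d \<in> Dred k"
  unfolding Dred_def by simp

lemma Dred_iff:
  assumes "d \<in> D" "k \<in> {x, y, z}" shows "d \<in> Dred k \<longleftrightarrow> c (sg (sg d)) = k"
  using assms(2) by (rule_tac col_cases[OF assms(1)]) (use assms(1) distinct in \<open>simp_all add: Dred_def, argo+\<close>)

lemma Dred_sg:
  assumes "d \<in> Dred k" "k \<in> {x, y, z}" shows "sg (al (sg d)) \<in> Dred k"
proof -
  have d: "d \<in> D" using assms Dred_subset by blast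
  then show ?thesis using assms Dred_iff[of d k] Dred_iff[of "sg (al (sg d))" k] by simp
qed

lemma inj_on_al: "inj_on al D" using bij_al bij_betw_imp_inj_on by blast
lemma inj_on_sg: "inj_on sg D" using bij_sg bij_betw_imp_inj_on by blast

lemma bij_sg_red:
  assumes "k \<in> {x, y, z}" shows "bij_betw (cm_sigma (red k)) (Dred k) (Dred k)"
proof -
  have "inj_on (cm_sigma (red k)) (Dred k)"
  proof (rule inj_onI)
    fix d e assume de: "d \<in> Dred k" "e \<in> Dred k" "cm_sigma (red k) d = cm_sigma (red k) e"
    then have D: "d \<in> D" "e \<in> D" using Dred_subset by auto
    have "al (sg d) = al (sg e)" using de(3) D inj_onD[OF inj_on_sg] by simp
    then have "sg d = sg e" using D inj_onD[OF inj_on_al] by simp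
    then show "d = e" using D inj_onD[OF inj_on_sg] by simp
  qed
  moreover have "cm_sigma (red k) ` Dred k \<subseteq> Dred k" using Dred_sg[OF _ assms] by auto
  ultimately show ?thesis using endo_inj_surj[OF finite_Dred] unfolding bij_betw_def by blast
qed

lemma bij_phi_red:
  assumes "k \<in> {x, y, z}" shows "bij_betw (cm_phi (red k)) (Dred k) (Dred k)"
proof -
  have "bij_betw al (Dred k) (Dred k)"
    by (rule bij_betw_byWitness[where f' = al]) (auto dest: subsetD[OF Dred_subset])
  then show ?thesis
    unfolding cm_phi_def al_red by (rule bij_betw_trans[OF _ bij_sg_red[OF assms]])
qed

text \<open>Along a face of another colour, surviving edges alternate with edges of contracted
  faces. The face permutation of the reduced graph makes two steps at once and thereby skips the
  latter.\<close>

lemma face_of_red: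
  assumes d: "d \<in> Dred k" and k: "k \<in> {x, y, z}"
  shows "face_of (red k) d = F d \<inter> Dred k"
proof
  have dD: "d \<in> D" using d Dred_subset by blast
  show "face_of (red k) d \<subseteq> F d \<inter> Dred k"
  proof
    fix e assume "e \<in> face_of (red k) d"
    then have e: "e \<in> orb (cm_phi (red k)) d" unfolding face_of_def .
    then have "e \<in> Dred k" using orb_subset[OF finite_Dred bij_phi_red[OF k] d] by blast
    moreover have "e \<in> D \<and> F e = F d"
      using e by (induction rule: orb_induct) (use dD in simp_all)
    ultimately show "e \<in> F d \<inter> Dred k" using F_mem[OF dD] by blast
  qed
  show "F d \<inter> Dred k \<subseteq> face_of (red k) d"
  proof
    fix e assume e: "e \<in> F d \<inter> Dred k"
    let ?o = "orb (cm_phi (red k)) d"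
    \<comment> \<open>The induction moves along the face by single steps; at a dart that does not
      survive, the claim is about the next one.\<close>
    have "(e \<in> Dred k \<longrightarrow> e \<in> ?o) \<and> (e \<notin> Dred k \<longrightarrow> sg (al e) \<in> ?o)"
    proof (rule F_induct[OF dD, of e])
      fix e assume ih: "e \<in> D" "F e = F d"
        "(e \<in> Dred k \<longrightarrow> e \<in> ?o) \<and> (e \<notin> Dred k \<longrightarrow> sg (al e) \<in> ?o)"
      show "(sg (al e) \<in> Dred k \<longrightarrow> sg (al e) \<in> ?o)
          \<and> (sg (al e) \<notin> Dred k \<longrightarrow> sg (al (sg (al e))) \<in> ?o)"
      proof (cases "e \<in> Dred k")
        case True
        then have "c (sg (sg (al e))) = k" using Dred_iff[OF ih(1) k] ih(1) by simp
        then have "sg (al e) \<notin> Dred k" unfolding Dred_def by simp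
        moreover have "cm_phi (red k) e \<in> ?o" by (rule orb_step) (use True ih in blast)
        ultimately show ?thesis by simp
      next
        case False
        then have "sg (al e) \<in> ?o" using ih by blast
        moreover then have "sg (al e) \<in> Dred k"
          using orb_subset[OF finite_Dred bij_phi_red[OF k] d] by blast
        ultimately show ?thesis by blast
      qed
    qed (use e d orb_self in auto)
    then show "e \<in> face_of (red k) d" using e unfolding face_of_def by blast
  qed
qed

text \<open>Around the vertex obtained by contracting a face, the rotation of the reduced graph runs
through the boundary of that face backwards.\<close>

lemma vert_of_red:
  assumes d: "d \<in> Dred k" and k: "k \<in> {x, y, z}"
  shows "vert_of (red k) d = sg ` F (sg (sg d))"
proof
  have dD: "d \<in> D" using d Dred_subset by blast
  have cd: "c (sg (sg d)) = k" using Dred_iff[OF dD k] d by blast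
  let ?s = "cm_sigma (red k)"
  show "vert_of (red k) d \<subseteq> sg ` F (sg (sg d))"
  proof
    fix e assume "e \<in> vert_of (red k) d"
    then have "e \<in> orb ?s d" unfolding vert_of_def .
    then have e: "e \<in> D \<and> F (sg (sg e)) = F (sg (sg d))"
      by (induction rule: orb_induct) (use dD in simp_all)
    then have "sg (sg e) \<in> F (sg (sg d))" using F_mem[of "sg (sg d)" "sg (sg e)"] dD by simp
    then have "sg (sg (sg e)) \<in> sg ` F (sg (sg d))" by (rule imageI)
    then show "e \<in> sg ` F (sg (sg d))" using e by simp
  qed
  show "sg ` F (sg (sg d)) \<subseteq> vert_of (red k) d"
  proof
    fix e assume "e \<in> sg ` F (sg (sg d))"
    then obtain g where g: "e = sg g" "g \<in> F (sg (sg d))" by blast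
    have dd: "sg (sg d) \<in> D" using dD by simp
    have "sg g \<in> orb ?s d"
    proof (rule F_induct[OF dd g(2)])
      show "sg (sg (sg d)) \<in> orb ?s d" using dD orb_self by simp
      fix g assume ih: "g \<in> D" "F g = F (sg (sg d))" "sg g \<in> orb ?s d"
      define h where "h = sg (sg (al g))"
      have "c (sg (sg h)) = k" using ih cd unfolding h_def by simp
      then have h: "h \<in> Dred k" using Dred_iff[of h k] ih k unfolding h_def by simp
      have "?s h = sg g" using ih unfolding h_def by simp
      then have "orb ?s h = orb ?s (sg g)"
        using orb_shift[OF finite_Dred bij_sg_red[OF k] h] by simp
      also have "\<dots> = orb ?s d"
        by (rule orb_eq[OF finite_Dred bij_sg_red[OF k] d ih(3)])
      finally show "sg (sg (al g)) \<in> orb ?s d" using orb_self[of h ?s] unfolding h_def by simp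
    qed
    then show "e \<in> vert_of (red k) d" unfolding g(1) vert_of_def .
  qed
qed

subsection \<open>Spanning trees of faces\<close>

lemma y_in: "y \<in> {x, y, z}" by simp

lemma face_dart:
  assumes "f \<in> faces M" "col f \<noteq> k" obtains d where "d \<in> Dred k" "f = F d"
proof -
  obtain d where d: "d \<in> D" "f = F d" using assms(1) unfolding faces_def by blast
  show thesis
  proof (cases "c (sg d) = k")
    case False
    then show thesis using that[of d] d assms(2) unfolding Dred_def by simp
  next
    case True
    have "c (sg (sg d)) \<noteq> k" using c_neq[of "sg d"] d True by simp
    then show thesis using that[of "sg (al d)"] d assms(2) unfolding Dred_def by simp
  qed
qed

lemma x_face_dart:
  assumes "f \<in> colour_class M col x" obtains d where "d \<in> Dred y" "f = F d" "c d = x"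
proof -
  have f: "f \<in> faces M" "col f = x" using assms unfolding colour_class_def by auto
  then show thesis using face_dart[of f y] that distinct by metis
qed

lemma face_from_colour_unique:
  assumes "face_from_colour M col i (red k) f" "face_from_colour M col j (red k) f" "k \<in> {x, y, z}"
  shows "i = j"
proof -
  obtain e where e: "e \<in> Dred k" "f = face_of (red k) e"
    using assms(1) unfolding face_from_colour_def faces_def by auto
  have eD: "e \<in> D" using e Dred_subset by blast
  have "f \<subseteq> F e" using face_of_red[OF e(1) assms(3)] e(2) by blast
  then have "c d = c e" if "d \<in> f" for d using that F_mem[OF eD, of d] by auto
  then show ?thesis using assms(1,2) unfolding face_from_colour_def by metis
qed

lemma face_of_red_colour:
  assumes "d \<in> Dred k" shows "face_from_colour M col (c d) (red k) (face_of (red k) d)"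
  using assms orb_self[of d] unfolding face_from_colour_def faces_def face_of_def[of "red k"] by auto

lemma faces_red_from_x:
  "{f. face_from_colour M col x (red y) f} = (\<lambda>f. f \<inter> Dred y) ` colour_class M col x"
proof
  show "{f. face_from_colour M col x (red y) f} \<subseteq> (\<lambda>f. f \<inter> Dred y) ` colour_class M col x"
  proof
    fix f assume "f \<in> {f. face_from_colour M col x (red y) f}"
    then obtain e d where e: "e \<in> Dred y" "f = face_of (red y) e" "d \<in> f" "c d = x"
      unfolding face_from_colour_def faces_def by auto
    have eD: "e \<in> D" using e Dred_subset by blast
    have f: "f = F e \<inter> Dred y" using e(2) face_of_red[OF e(1) y_in] by simp
    then have "F d = F e" using e(3) F_mem[OF eD] by blast
    then have "F e \<in> colour_class M col x" using e(4) eD unfolding colour_class_def by simp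
    then show "f \<in> (\<lambda>f. f \<inter> Dred y) ` colour_class M col x" using f by blast
  qed
  show "(\<lambda>f. f \<inter> Dred y) ` colour_class M col x \<subseteq> {f. face_from_colour M col x (red y) f}"
  proof
    fix g assume "g \<in> (\<lambda>f. f \<inter> Dred y) ` colour_class M col x"
    then obtain f where f: "g = f \<inter> Dred y" "f \<in> colour_class M col x" by blast
    obtain d where d: "d \<in> Dred y" "f = F d" "c d = x" using x_face_dart[OF f(2)] .
    have "d \<in> D" using d Dred_subset by blast
    then have "g = face_of (red y) d" "d \<in> g"
      using f(1) d face_of_red[OF d(1) y_in] F_mem[of d d] by auto
    then show "g \<in> {f. face_from_colour M col x (red y) f}"
      using d unfolding face_from_colour_def faces_def by auto
  qed
qed

text \<open>The vertex of the radial graph that belongs to a node. By \<open>vert_of_red\<close>, a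
  contracted \<open>y\<close>-face becomes the vertex made of the images of its darts under
  \<open>sg\<close>; an \<open>x\<close>-face keeps its surviving darts.\<close>

definition rnode :: "'d set \<Rightarrow> 'd set + 'd set" where
  "rnode f = (if col f = y then Inl (sg ` f) else Inr (f \<inter> Dred y))"

lemma inj_on_rnode:
  assumes T: "T \<subseteq> colour_class M col x" shows "inj_on rnode (nodes T)"
proof (rule inj_onI)
  fix f g assume fg: "f \<in> nodes T" "g \<in> nodes T" "rnode f = rnode g"
  have cc: "h \<in> colour_class M col y \<or> h \<in> colour_class M col x" if "h \<in> nodes T" for h
    using that T unfolding nodes_def by blast
  have sub: "h \<subseteq> D" if "h \<in> nodes T" for h
    using cc[OF that] F_mem unfolding colour_class_iff by blast
  show "f = g"
  proof (cases "col f = y")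
    case True
    then have "sg ` f = sg ` g" using fg(3) unfolding rnode_def by (auto split: if_splits)
    then show ?thesis using inj_on_image_eq_iff[OF inj_on_sg] sub fg by blast
  next
    case False
    then have eq: "f \<inter> Dred y = g \<inter> Dred y" "col g \<noteq> y"
      using fg(3) unfolding rnode_def by (auto split: if_splits)
    then have x: "f \<in> colour_class M col x" "g \<in> colour_class M col x"
      using cc[OF fg(1)] cc[OF fg(2)] False unfolding colour_class_def by auto
    obtain d where d: "d \<in> Dred y" "f = F d" using x_face_dart[OF x(1)] by metis
    have dD: "d \<in> D" using d Dred_subset by blast
    then have "d \<in> g" using eq(1) d F_mem[of d d] by blast
    moreover obtain e where "e \<in> D" "g = F e" using x(2) colour_class_iff by blast
    ultimately show ?thesis using d F_mem by blast
  qed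
qed

lemma verts_red: "verts (red y) = (\<lambda>f. sg ` f) ` colour_class M col y"
proof
  show "verts (red y) \<subseteq> (\<lambda>f. sg ` f) ` colour_class M col y"
  proof
    fix v assume "v \<in> verts (red y)"
    then obtain d where d: "d \<in> Dred y" "v = vert_of (red y) d" unfolding verts_def by auto
    then have dD: "d \<in> D" using Dred_subset by blast
    have "F (sg (sg d)) \<in> colour_class M col y"
      using dD Dred_iff[OF dD y_in] d(1) unfolding colour_class_def by simp
    then show "v \<in> (\<lambda>f. sg ` f) ` colour_class M col y"
      using d vert_of_red[OF d(1) y_in] by blast
  qed
  show "(\<lambda>f. sg ` f) ` colour_class M col y \<subseteq> verts (red y)"
  proof
    fix v assume "v \<in> (\<lambda>f. sg ` f) ` colour_class M col y"
    then obtain f where f: "f \<in> colour_class M col y" "v = sg ` f" by blast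
    obtain d where d: "d \<in> D" "f = F d" "c d = y" using f(1) colour_class_iff by blast
    have s: "sg d \<in> Dred y" using d Dred_iff[of "sg d" y] by simp
    then have "v = vert_of (red y) (sg d)" using vert_of_red[OF s y_in] d f(2) by simp
    then show "v \<in> verts (red y)" using s unfolding verts_def by simp
  qed
qed

lemma rnode_image:
  assumes T: "T \<subseteq> colour_class M col x"
  shows "Inl ` verts (red y) \<union> Inr ` (\<lambda>f. f \<inter> Dred y) ` T = rnode ` nodes T"
proof -
  have "rnode f = Inl (sg ` f)" if "f \<in> colour_class M col y" for f
    using that unfolding rnode_def colour_class_def by simp
  moreover have "rnode f = Inr (f \<inter> Dred y)" if "f \<in> T" for f
    using that T distinct unfolding rnode_def colour_class_def by auto
  ultimately show ?thesis unfolding verts_red nodes_def image_Un image_image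
    by (metis (no_types, lifting) image_cong)
qed

text \<open>A vertex and a face of the reduced graph meet in a dart \<open>e\<close>. The dart
  before \<open>e\<close> on the \<open>x\<close>-face is \<open>al (sg (sg e))\<close>, and its
  edge separates this face from the contracted \<open>y\<close>-face. So incidences come from glued
  edges, and each glued edge yields one.\<close>

lemma radial_edges_red:
  assumes T: "T \<subseteq> colour_class M col x"
  shows "radial_edges (red y) ((\<lambda>f. f \<inter> Dred y) ` T)
    = (\<lambda>d. (rnode (F (al d)), rnode (F d))) ` glue T"
proof
  show "radial_edges (red y) ((\<lambda>f. f \<inter> Dred y) ` T)
    \<subseteq> (\<lambda>d. (rnode (F (al d)), rnode (F d))) ` glue T"
  proof
    fix p assume "p \<in> radial_edges (red y) ((\<lambda>f. f \<inter> Dred y) ` T)"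
    then obtain v f e where p: "p = (Inl v, Inr (f \<inter> Dred y))" "v \<in> verts (red y)" "f \<in> T"
      "e \<in> v" "e \<in> f" "e \<in> Dred y"
      unfolding radial_edges_def by blast
    have e: "e \<in> D" using p Dred_subset by blast
    obtain d where "d \<in> D" "f = F d" "c d = x" using p(3) T colour_class_iff by blast
    then have f: "f = F e" "c e = x" using p(5) F_mem by auto
    obtain i where i: "i \<in> Dred y" "v = vert_of (red y) i" using p(2) unfolding verts_def by auto
    have "vert_of (red y) e = v"
      using orb_eq[OF finite_Dred bij_sg_red[OF y_in] i(1)] p(4) i(2) unfolding vert_of_def by blast
    then have v: "v = sg ` F (sg (sg e))" using vert_of_red[OF p(6) y_in] by simp
    have ce: "c (sg (sg e)) = y" using Dred_iff[OF e y_in] p(6) by blast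
    have "al (sg (sg e)) \<in> glue T" using e f ce p(3) unfolding glue_def by simp
    moreover have "p = (rnode (F (al (al (sg (sg e))))), rnode (F (al (sg (sg e)))))"
      unfolding p(1) rnode_def using e ce f v distinct by simp
    ultimately show "p \<in> (\<lambda>d. (rnode (F (al d)), rnode (F d))) ` glue T" by blast
  qed
  show "(\<lambda>d. (rnode (F (al d)), rnode (F d))) ` glue T
    \<subseteq> radial_edges (red y) ((\<lambda>f. f \<inter> Dred y) ` T)"
  proof
    fix p assume "p \<in> (\<lambda>d. (rnode (F (al d)), rnode (F d))) ` glue T"
    then obtain d where p: "p = (rnode (F (al d)), rnode (F d))" "d \<in> glue T" by blast
    then have d: "d \<in> D" "c d = x" "c (al d) = y" "F d \<in> T" unfolding glue_def by blast+
    define e where "e = sg (al d)"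
    have e: "e \<in> Dred y" using Dred_iff[of e y] d unfolding e_def by simp
    have "rnode (F (al d)) = Inl (vert_of (red y) e)"
      using vert_of_red[OF e y_in] d unfolding e_def rnode_def by simp
    moreover have "rnode (F d) = Inr (F d \<inter> Dred y)" using d distinct unfolding rnode_def by simp
    moreover have "e \<in> vert_of (red y) e" unfolding vert_of_def by (rule orb_self)
    moreover have "e \<in> F d \<inter> Dred y" using e F_mem[OF d(1), of e] d unfolding e_def by simp
    moreover have "vert_of (red y) e \<in> verts (red y)" using e unfolding verts_def by simp
    ultimately show "p \<in> radial_edges (red y) ((\<lambda>f. f \<inter> Dred y) ` T)"
      using p(1) d(4) unfolding radial_edges_def by blast
  qed
qed

text \<open>As \<open>f0\<close> does not come from an \<open>x\<close>-face, it is avoided by every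
  set of faces that do. This form serves for the outer faces of both \<open>H'\<close> and
  \<open>H''\<close>.\<close>

lemma spanning_tree_of_faces_iff:
  assumes outer: "\<not> face_from_colour M col x (red y) f0"
  shows "(\<exists>T. (\<forall>f\<in>T. face_from_colour M col x (red y) f) \<and> spanning_tree_of_faces (red y) f0 T)
    \<longleftrightarrow> (\<exists>T \<subseteq> colour_class M col x. single_cycle T)"
proof
  assume "\<exists>T. (\<forall>f\<in>T. face_from_colour M col x (red y) f) \<and> spanning_tree_of_faces (red y) f0 T"
  then obtain T' where T': "\<forall>f\<in>T'. face_from_colour M col x (red y) f"
    "is_tree (Inl ` verts (red y) \<union> Inr ` T') (radial_edges (red y) T')"
    unfolding spanning_tree_of_faces_def by blast
  define T where "T = {f \<in> colour_class M col x. f \<inter> Dred y \<in> T'}"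
  have T: "T \<subseteq> colour_class M col x" unfolding T_def by blast
  have "T' = (\<lambda>f. f \<inter> Dred y) ` T"
  proof
    show "T' \<subseteq> (\<lambda>f. f \<inter> Dred y) ` T"
    proof
      fix f assume f: "f \<in> T'"
      then have "f \<in> (\<lambda>f. f \<inter> Dred y) ` colour_class M col x"
        using T'(1) faces_red_from_x by blast
      then show "f \<in> (\<lambda>f. f \<inter> Dred y) ` T" using f unfolding T_def by blast
    qed
  qed (auto simp: T_def)
  then have tree: "is_tree (rnode ` nodes T) ((\<lambda>d. (rnode (F (al d)), rnode (F d))) ` glue T)"
    using T'(2) rnode_image[OF T] radial_edges_red[OF T] by simp
  have inj: "inj_on (\<lambda>d. (rnode (F (al d)), rnode (F d))) (glue T)"
  proof (rule inj_onI)
    fix d e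
    assume de: "d \<in> glue T" "e \<in> glue T"
      "(rnode (F (al d)), rnode (F d)) = (rnode (F (al e)), rnode (F e))"
    have "F d = F e" "F (al d) = F (al e)"
      using de inj_onD[OF inj_on_rnode[OF T]] glue_ends[of d T] glue_ends[of e T] by blast+
    moreover have "d \<in> between x y" "e \<in> between x y"
      using de unfolding glue_def between_def by blast+
    ultimately show "d = e" using parallel_eq by blast
  qed
  note imD = is_tree_imageD[where s = F and t = "\<lambda>d. F (al d)", OF inj_on_rnode[OF T] inj glue_ends tree]
  have "single_cycle T" by (rule tree_imp_single_cycle[OF T imD])
  then show "\<exists>T \<subseteq> colour_class M col x. single_cycle T" using T by blast
next
  assume "\<exists>T \<subseteq> colour_class M col x. single_cycle T"
  then obtain T where T: "T \<subseteq> colour_class M col x" "single_cycle T" by blast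
  let ?T = "(\<lambda>f. f \<inter> Dred y) ` T"
  have fc: "face_from_colour M col x (red y) f" if "f \<in> ?T" for f
    using that T(1) faces_red_from_x by blast
  then have "?T \<subseteq> faces (red y) - {f0}"
    using outer unfolding face_from_colour_def by blast
  moreover have "is_tree (rnode ` nodes T) ((\<lambda>d. (rnode (F (al d)), rnode (F d))) ` glue T)"
    by (rule is_tree_imageI[where s = F and t = "\<lambda>d. F (al d)",
          OF finite_nodes[OF T(1)] finite_glue inj_on_rnode[OF T(1)] glue_ends
            single_cycle_imp_conn[OF T] single_cycle_card[OF T]])
  ultimately have "spanning_tree_of_faces (red y) f0 ?T"
    unfolding spanning_tree_of_faces_def rnode_image[OF T(1)] radial_edges_red[OF T(1)] by blast
  then show "\<exists>T. (\<forall>f\<in>T. face_from_colour M col x (red y) f) \<and> spanning_tree_of_faces (red y) f0 T"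
    using fc by blast
qed

section \<open>Edges between \<open>y\<close>-faces and \<open>z\<close>-faces\<close>

lemma x_in: "x \<in> {x, y, z}" by simp

lemma Dred_x:
  assumes "e \<in> Dred x"
  shows "e \<in> D" "c (sg (sg e)) = x" "c e = y \<and> c (sg e) = z \<or> c e = z \<and> c (sg e) = y"
proof -
  show eD: "e \<in> D" using assms Dred_subset by blast
  show c3: "c (sg (sg e)) = x" using Dred_iff[OF eD x_in] assms by blast
  show "c e = y \<and> c (sg e) = z \<or> c e = z \<and> c (sg e) = y"
    by (rule col_cases[OF eD]) (use c3 distinct in simp_all)
qed

lemma Dred_x_I: "e \<in> D \<Longrightarrow> c (sg (sg e)) = x \<Longrightarrow> e \<in> Dred x"
  using Dred_iff[OF _ x_in] by blast

text \<open>The dart at the vertex of \<open>d\<close> whose edge borders no \<open>x\<close>-face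
  and so belongs to every \<open>cyc T\<close>. Through it the vertices of \<open>M\<close>
  correspond to the darts of \<open>red x\<close>.\<close>

definition xdart :: "'d \<Rightarrow> 'd" where
  "xdart d = (if d \<in> Dred x then d else if sg d \<in> Dred x then sg d else sg (sg d))"

lemma xdart:
  assumes "d \<in> D"
  shows "xdart d \<in> Dred x" "xdart (sg d) = xdart d" "xdart d \<in> {d, sg d, sg (sg d)}"
proof -
  have iff: "d \<in> Dred x \<longleftrightarrow> c (sg (sg d)) = x" "sg d \<in> Dred x \<longleftrightarrow> c d = x"
    "sg (sg d) \<in> Dred x \<longleftrightarrow> c (sg d) = x"
    using assms Dred_iff[of d x] Dred_iff[of "sg d" x] Dred_iff[of "sg (sg d)" x] by simp_all
  show "xdart d \<in> Dred x" "xdart (sg d) = xdart d"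
    unfolding xdart_def sg_sg_sg[OF assms] iff
    by (rule_tac [!] col_cases[OF assms]) (use iff distinct in simp_all)
  show "xdart d \<in> {d, sg d, sg (sg d)}" unfolding xdart_def by simp
qed

lemma cyc_Dred: "e \<in> Dred x \<Longrightarrow> e \<in> cyc T"
  unfolding cyc_def Dred_def by auto

lemma cyc_sg_iff:
  assumes "e \<in> Dred x" shows "sg e \<in> cyc T \<longleftrightarrow> (c e = y \<longleftrightarrow> F (sg (sg e)) \<in> T)"
  using Dred_x[OF assms] distinct unfolding cyc_def by auto

lemma cyc_sg_sg_iff:
  assumes "e \<in> Dred x" shows "sg (sg e) \<in> cyc T \<longleftrightarrow> sg e \<notin> cyc T"
  unfolding cyc_sg_iff[OF assms] using Dred_x[OF assms] distinct unfolding cyc_def by auto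

subsection \<open>A-trails\<close>

text \<open>The rotation of \<open>red x\<close>. From \<open>e\<close> to \<open>sH e\<close> one
  follows the edge of \<open>sg e\<close> on the contracted face. The 2-factor therefore pairs the
  darts at each contracted face with neighbours in the rotation, in one of two alternating ways: if
  the face is in \<open>T\<close>, the darts of colour \<open>y\<close> are paired with their
  successors, otherwise those of colour \<open>z\<close>.\<close>

abbreviation sH where "sH d \<equiv> sg (al (sg d))"

lemma sH:
  assumes "e \<in> Dred x"
  shows "sH e \<in> Dred x" "F (sg (sg (sH e))) = F (sg (sg e))" "c (sH e) = c (sg e)" "c (sg (sH e)) = c e"
  using Dred_x[OF assms] Dred_sg[OF assms x_in] by simp_all

lemma sH_inj: "d \<in> Dred x \<Longrightarrow> e \<in> Dred x \<Longrightarrow> sH d = sH e \<Longrightarrow> d = e"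
  using bij_sg_red[OF x_in] unfolding bij_betw_def inj_on_def by simp

lemma Q_sH:
  assumes "\<And>d. d \<in> D \<Longrightarrow> Q (sg d) = Q d" "\<And>d. d \<in> cyc T \<Longrightarrow> Q (al d) = Q d"
    "e \<in> Dred x" "sg e \<in> cyc T"
  shows "Q (sH e) = Q e"
proof -
  have "e \<in> D" using Dred_x assms(3) by blast
  then show ?thesis using assms(1)[of e] assms(1)[of "al (sg e)"] assms(2)[OF assms(4)] by simp
qed

text \<open>Whenever the trail passes a vertex, it pairs the reverse of the arriving dart with the
  departing one. In an A-trail partners are neighbours in the rotation, so at every vertex the
  pairing is one of the two alternating ones, and these choices define \<open>T\<close>. Following
  the trail then amounts to following the 2-factor.\<close>

lemma A_trail_imp_single_cycle:
  assumes "A_trail (red x) ds"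
  obtains T where "T \<subseteq> colour_class M col x" "single_cycle T"
proof -
  define n where "n = length ds"
  define nx where "nx i = (i + 1) mod n" for i
  have ds: "n > 0" "distinct ds" "set ds \<subseteq> Dred x" "\<And>d. d \<in> Dred x \<Longrightarrow> d \<in> set ds \<or> al d \<in> set ds"
    "\<And>d. d \<in> set ds \<Longrightarrow> al d \<notin> set ds"
    and turn: "\<And>i. i < n \<Longrightarrow> ds ! nx i = sH (al (ds ! i)) \<or> al (ds ! i) = sH (ds ! nx i)"
    using assms unfolding A_trail_def eulerian_trail_def n_def nx_def by auto
  have nx: "nx i < n" for i using ds(1) unfolding nx_def by simp
  have nx_inj: "i = j" if "nx i = nx j" "i < n" "j < n" for i j
    using that unfolding nx_def by (metis Suc_eq_plus1 Suc_lessI mod_less mod_self nat.inject nat.simps(3))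
  have nx_surj: "\<exists>i<n. nx i = j" if "j < n" for j
  proof (cases j)
    case 0
    then show ?thesis using ds(1) unfolding nx_def by (intro exI[of _ "n - 1"]) simp
  next
    case (Suc i)
    then show ?thesis using that unfolding nx_def by (intro exI[of _ i]) simp
  qed
  have dsD: "ds ! i \<in> Dred x" "ds ! i \<in> set ds" "ds ! i \<in> D" if "i < n" for i
    using that ds(3) Dred_subset unfolding n_def by (auto dest: nth_mem)
  define Pr where "Pr d e \<longleftrightarrow> (\<exists>i<n. d = al (ds ! i) \<and> e = ds ! nx i \<or> e = al (ds ! i) \<and> d = ds ! nx i)"
    for d e
  have Pr_sym: "Pr e d" if "Pr d e" for d e using that unfolding Pr_def by blast
  have Pr_turn: "e = sH d \<or> d = sH e" if "Pr d e" for d e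
    using that turn unfolding Pr_def by metis
  have Pr_total: "\<exists>e. Pr d e" if "d \<in> Dred x" for d
    using ds(4)[OF that]
  proof
    assume "d \<in> set ds"
    then obtain j where "j < n" "d = ds ! j" unfolding n_def by (metis in_set_conv_nth)
    then show ?thesis using nx_surj[of j] unfolding Pr_def by blast
  next
    assume "al d \<in> set ds"
    then obtain j where "j < n" "al d = ds ! j" unfolding n_def by (metis in_set_conv_nth)
    moreover have "d = al (al d)" using al_al[OF Dred_x(1)[OF that]] by simp
    ultimately show ?thesis unfolding Pr_def by metis
  qed
  have Pr_fun: "e = e'" if P: "Pr d e" "Pr d e'" for d e e'
  proof -
    obtain i where i: "i < n" "d = al (ds ! i) \<and> e = ds ! nx i \<or> e = al (ds ! i) \<and> d = ds ! nx i"
      using P(1) unfolding Pr_def by blast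
    obtain j where j: "j < n" "d = al (ds ! j) \<and> e' = ds ! nx j \<or> e' = al (ds ! j) \<and> d = ds ! nx j"
      using P(2) unfolding Pr_def by blast
    \<comment> \<open>No edge is traversed in both directions, so a dart cannot occur both as a
      departing dart and as the reverse of an arriving one.\<close>
    have clash: "al (ds ! k) \<noteq> ds ! nx l" if "k < n" for k l
      using ds(5)[OF dsD(2)[OF that]] dsD(2)[OF nx] by metis
    have "i = j"
    proof (cases "d = al (ds ! i)")
      case True
      then have "al (ds ! i) = al (ds ! j)" using j clash[OF i(1)] by metis
      then have "ds ! i = ds ! j" using inj_onD[OF inj_on_al] dsD(3) i j by blast
      then show ?thesis using ds(2) i j unfolding n_def by (simp add: nth_eq_iff_index_eq)
    next
      case False
      then have "ds ! nx i = ds ! nx j" using i j clash[OF j(1)] by metis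
      then have "nx i = nx j" using ds(2) nx[of i] nx[of j] unfolding n_def by (simp add: nth_eq_iff_index_eq)
      then show ?thesis using nx_inj i j by blast
    qed
    then show ?thesis using i j clash by metis
  qed
  \<comment> \<open>The witness \<open>g\<close> is needed at vertices of degree 2, where both pairings coincide.\<close>
  have bad: "(c e = y \<longrightarrow> \<not> Pr e (sH e)) \<and>
      (c e = z \<longrightarrow> Pr e (sH e) \<and> (\<exists>g\<in>Dred x. e = sH g \<and> \<not> Pr g e))"
    if d: "d \<in> Dred x" "c d = y" "\<not> Pr d (sH d)" and e: "e \<in> vert_of (red x) d" for d e
  proof -
    have "e \<in> orb (cm_sigma (red x)) d" using e unfolding vert_of_def .
    then have "e \<in> Dred x \<and> (c e = y \<longrightarrow> \<not> Pr e (sH e)) \<and>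
      (c e = z \<longrightarrow> Pr e (sH e) \<and> (\<exists>g\<in>Dred x. e = sH g \<and> \<not> Pr g e))"
    proof (induction rule: orb_induct)
      case self
      then show ?case using d distinct by simp
    next
      case (step e)
      then have eD: "e \<in> Dred x" by blast
      note ce = Dred_x(3)[OF eD]
      have "(c (sH e) = y \<longrightarrow> \<not> Pr (sH e) (sH (sH e))) \<and>
        (c (sH e) = z \<longrightarrow> Pr (sH e) (sH (sH e)) \<and> (\<exists>g\<in>Dred x. sH e = sH g \<and> \<not> Pr g (sH e)))"
      proof (cases "c e = y")
        case True
        then have nP: "\<not> Pr e (sH e)" using step(2) by blast
        obtain g where g: "Pr (sH e) g" using Pr_total[OF sH(1)[OF eD]] by blast
        have gD: "g \<in> Dred x"
          using g dsD(1) nx Dred_al unfolding Pr_def by metis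
        have "g = sH (sH e)"
        proof (rule ccontr)
          assume "g \<noteq> sH (sH e)"
          then have "sH e = sH g" using Pr_turn[OF g] by blast
          then have "e = g" using sH_inj eD gD by blast
          then show False using nP Pr_sym[OF g] by blast
        qed
        then have "Pr (sH e) (sH (sH e))" using g by blast
        moreover have "c (sH e) \<noteq> y" using ce True distinct sH(3)[OF eD] by auto
        ultimately show ?thesis using nP eD by blast
      next
        case False
        then have cz: "c e = z" "c (sH e) = y" using ce sH(3)[OF eD] by auto
        then obtain g where g: "Pr e (sH e)" "g \<in> Dred x" "e = sH g" "\<not> Pr g e" using step(2) by blast
        have "\<not> Pr (sH e) (sH (sH e))"
        proof
          assume "Pr (sH e) (sH (sH e))"
          then have "sH (sH e) = e" using Pr_fun Pr_sym[OF g(1)] by blast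
          then have "sH e = g" using g(2,3) sH_inj[OF sH(1)[OF eD] g(2)] by simp
          then show False using g(4) Pr_sym[OF g(1)] by blast
        qed
        then show ?thesis using cz distinct by simp
      qed
      then show ?case using sH(1)[OF eD] by simp
    qed
    then show ?thesis by blast
  qed
  \<comment> \<open>By \<open>bad\<close>, one dart of colour \<open>y\<close> that is not paired
    with its successor implies the same for all of them at this vertex. So the condition can be
    tested on any one of these darts.\<close>
  define T where "T = {f \<in> colour_class M col x. \<forall>d\<in>Dred x. c d = y \<and> F (sg (sg d)) = f \<longrightarrow> Pr d (sH d)}"
  have T_iff: "F (sg (sg e)) \<in> T \<longleftrightarrow> Pr e (sH e)" if e: "e \<in> Dred x" "c e = y" for e
  proof
    assume "F (sg (sg e)) \<in> T"
    then show "Pr e (sH e)" using e unfolding T_def by blast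
  next
    assume P: "Pr e (sH e)"
    have "Pr d (sH d)" if d: "d \<in> Dred x" "c d = y" "F (sg (sg d)) = F (sg (sg e))" for d
    proof (rule ccontr)
      assume "\<not> Pr d (sH d)"
      moreover have "e \<in> vert_of (red x) d"
        unfolding vert_of_red[OF d(1) x_in] d(3) vert_of_red[OF e(1) x_in, symmetric]
        by (simp add: vert_of_def orb_self)
      ultimately show False using bad[of d e] d e P by blast
    qed
    moreover have "F (sg (sg e)) \<in> colour_class M col x"
      using Dred_x[OF e(1)] unfolding colour_class_def by simp
    ultimately show "F (sg (sg e)) \<in> T" unfolding T_def by blast
  qed
  have "single_cycle T"
  proof (rule single_cycleI)
    fix Q :: "'d \<Rightarrow> bool" and d e
    assume Qs: "\<And>d. d \<in> D \<Longrightarrow> Q (sg d) = Q d" and Qc: "\<And>d. d \<in> cyc T \<Longrightarrow> Q (al d) = Q d"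
      and de: "d \<in> D" "e \<in> D"
    have y: "Q (sH e) = Q e" if e: "e \<in> Dred x" "c e = y" "Pr e (sH e)" for e
      by (rule Q_sH[where Q = Q, OF Qs Qc e(1)]) (use cyc_sg_iff[OF e(1)] T_iff e in auto)
    have step: "Q (sH e) = Q e" if e: "e \<in> Dred x" "Pr e (sH e)" for e
    proof (cases "c e = y")
      case False
      show ?thesis
      proof (cases "F (sg (sg e)) \<in> T")
        \<comment> \<open>A dart of colour \<open>z\<close> is paired with its successor at a face
          in \<open>T\<close> only if the contracted vertex has degree 2. There the successor of the
          successor is the dart itself.\<close>
        case True
        have s: "sH e \<in> Dred x" "c (sH e) = y" using sH[OF e(1)] Dred_x(3)[OF e(1)] False by auto
        then have P: "Pr (sH e) (sH (sH e))" using T_iff[OF s] sH(2)[OF e(1)] True by simp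
        then have "sH (sH e) = e" using Pr_fun Pr_sym[OF e(2)] by blast
        then show ?thesis using y[OF s P] by simp
      next
        case F: False
        show ?thesis
          by (rule Q_sH[where Q = Q, OF Qs Qc e(1)]) (use cyc_sg_iff[OF e(1)] False F in auto)
      qed
    qed (use y e in blast)
    have Pr_Q: "Q e = Q d" if "d \<in> Dred x" "e \<in> Dred x" "Pr d e" for d e
      using Pr_turn[OF that(3)] step[of d] step[of e] that Pr_sym[OF that(3)] by blast
    have next_Q: "Q (ds ! nx i) = Q (ds ! i)" if "i < n" for i
    proof -
      have "Pr (al (ds ! i)) (ds ! nx i)" using that unfolding Pr_def by blast
      then have "Q (ds ! nx i) = Q (al (ds ! i))"
        using Pr_Q dsD(1)[OF that] dsD(1)[OF nx] Dred_al by blast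
      then show ?thesis using Qc[OF cyc_Dred[OF dsD(1)[OF that]]] by simp
    qed
    have all: "Q (ds ! i) = Q (ds ! 0)" if "i < n" for i
      using that
    proof (induction i)
      case (Suc i)
      then have "nx i = Suc i" unfolding nx_def by simp
      then show ?case using next_Q[of i] Suc by simp
    qed simp
    have set: "Q d = Q (ds ! 0)" if "d \<in> set ds" for d
      using that all unfolding n_def by (metis in_set_conv_nth)
    have red: "Q d = Q (ds ! 0)" if "d \<in> Dred x" for d
      using ds(4)[OF that] set[of d] set[of "al d"] Qc[OF cyc_Dred[OF that]] by blast
    have "Q d = Q (ds ! 0)" if "d \<in> D" for d
    proof -
      have "Q (xdart d) = Q d" using xdart(3)[OF that] Qs that by auto
      then show ?thesis using red[OF xdart(1)[OF that]] by simp
    qed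
    then show "Q d = Q e" using de by simp
  qed
  moreover have "T \<subseteq> colour_class M col x" unfolding T_def by blast
  ultimately show thesis using that by blast
qed

text \<open>The permutation \<open>\<tau>\<close> sends an edge to the next one along the 2-factor. It preserves the colour to the
right, so none of its orbits traverses an edge in both directions.\<close>

lemma A_trail_edge_perm:
  fixes T
  defines "\<tau> \<equiv> \<lambda>d. if F (sg (sg (al d))) \<in> T then sg (sg (al (sg (sg (al d))))) else sH (al d)"
    and "P \<equiv> {d \<in> Dred x. c d = y}"
  shows "bij_betw \<tau> P P"
    and "\<And>d. d \<in> P \<Longrightarrow> \<tau> d = sH (al d) \<or> al d = sH (\<tau> d)"
    and "\<And>e. e \<in> Dred x \<Longrightarrow> c e = y \<Longrightarrow> F (sg (sg e)) \<in> T \<Longrightarrow> \<tau> (al (sH e)) = e"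
    and "\<And>e. e \<in> Dred x \<Longrightarrow> c e = z \<Longrightarrow> F (sg (sg e)) \<notin> T \<Longrightarrow> \<tau> (al e) = sH e"
proof -
  \<comment> \<open>The term \<open>sg (sg (al (sg (sg a))))\<close> is the predecessor of
    \<open>a\<close> in the rotation of \<open>red x\<close>. The arriving dart \<open>al d\<close>
    has colour \<open>z\<close>; its partner is its predecessor at a face in \<open>T\<close> and
    its successor elsewhere.\<close>
  have D: "d \<in> D" "c (sg d) = z" "c (sg (sg d)) = x" "al d \<in> Dred x" if "d \<in> P" for d
    using Dred_x[of d] that distinct Dred_al[of d x] unfolding P_def by auto
  have face: "F (sg (sg (\<tau> d))) = F (sg (sg (al d)))" if "d \<in> P" for d
    using D[OF that] unfolding \<tau>_def by simp
  have inP: "\<tau> d \<in> P" if "d \<in> P" for d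
  proof -
    have "\<tau> d \<in> D" using D[OF that] unfolding \<tau>_def by simp
    moreover have "c (sg (sg (\<tau> d))) = x" using face[OF that] D[OF that] by simp
    moreover have "c (\<tau> d) = y" using D[OF that] that unfolding \<tau>_def P_def by simp
    ultimately show ?thesis using Dred_x_I unfolding P_def by blast
  qed
  have inj: "inj_on \<tau> P"
  proof (rule inj_onI)
    fix d e assume de: "d \<in> P" "e \<in> P" "\<tau> d = \<tau> e"
    have DD: "d \<in> D" "e \<in> D" "al d \<in> Dred x" "al e \<in> Dred x" using D de by auto
    have "F (sg (sg (al d))) = F (sg (sg (al e)))" using face[OF de(1)] face[OF de(2)] de(3) by simp
    then have "sg (sg (al (sg (sg (al d))))) = sg (sg (al (sg (sg (al e)))))
        \<or> sH (al d) = sH (al e)"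
      using de(3) unfolding \<tau>_def by (auto split: if_splits)
    then have "al d = al e"
    proof
      assume "sg (sg (al (sg (sg (al d))))) = sg (sg (al (sg (sg (al e)))))"
      then have "sH (sg (sg (al (sg (sg (al d)))))) = sH (sg (sg (al (sg (sg (al e))))))" by simp
      then show ?thesis using DD by simp
    qed (use sH_inj DD in blast)
    then show "d = e" using inj_onD[OF inj_on_al] DD by blast
  qed
  have "finite P" unfolding P_def by simp
  then show "bij_betw \<tau> P P"
    using endo_inj_surj[of P \<tau>] inj inP unfolding bij_betw_def by blast
  show "\<tau> d = sH (al d) \<or> al d = sH (\<tau> d)" if "d \<in> P" for d
    using D[OF that] unfolding \<tau>_def by simp
  show "\<tau> (al (sH e)) = e" if "e \<in> Dred x" "c e = y" "F (sg (sg e)) \<in> T" for e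
    using that Dred_x(1)[OF that(1)] unfolding \<tau>_def by simp
  show "\<tau> (al e) = sH e" if "e \<in> Dred x" "c e = z" "F (sg (sg e)) \<notin> T" for e
    using that Dred_x(1)[OF that(1)] unfolding \<tau>_def by simp
qed

text \<open>An orbit of \<open>\<tau>\<close> is a closed trail with the required turns. Whether it
  covers an edge does not change along the 2-factor, so if that is a single cycle, one orbit covers
  all edges.\<close>

lemma single_cycle_imp_A_trail:
  assumes single: "single_cycle T"
  obtains ds where "A_trail (red x) ds"
proof -
  obtain \<tau> P where P: "P = {d \<in> Dred x. c d = y}" and bij: "bij_betw \<tau> P P"
    and turn: "\<And>d. d \<in> P \<Longrightarrow> \<tau> d = sH (al d) \<or> al d = sH (\<tau> d)"
    and \<tau>_y: "\<And>e. e \<in> Dred x \<Longrightarrow> c e = y \<Longrightarrow> F (sg (sg e)) \<in> T \<Longrightarrow> \<tau> (al (sH e)) = e"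
    and \<tau>_z: "\<And>e. e \<in> Dred x \<Longrightarrow> c e = z \<Longrightarrow> F (sg (sg e)) \<notin> T \<Longrightarrow> \<tau> (al e) = sH e"
    by (rule that[OF refl A_trail_edge_perm[where T = T]])
  have finP: "finite P" unfolding P by simp
  have P_al: "al d \<in> P" if "d \<in> Dred x" "c d = z" for d
    using that Dred_x[OF that(1)] distinct unfolding P by auto
  have notP: "al d \<notin> P" if "d \<in> P" for d
    using that Dred_x[of d] distinct unfolding P by auto
  obtain d1 where "d1 \<in> Dred x" using xdart(1) D_nonempty by blast
  then obtain d0 where d0: "d0 \<in> P" using P_al[of d1] Dred_x(3)[of d1] unfolding P by blast
  define O' where "O' = orb \<tau> d0"
  have O_P: "O' \<subseteq> P" unfolding O'_def by (rule orb_subset[OF finP bij d0])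
  have O_step: "\<tau> d \<in> O' \<longleftrightarrow> d \<in> O'" if "d \<in> P" for d
  proof
    assume "d \<in> O'" then show "\<tau> d \<in> O'" unfolding O'_def by (rule orb_step)
  next
    assume "\<tau> d \<in> O'"
    then have "orb \<tau> (\<tau> d) = orb \<tau> d0" unfolding O'_def by (rule orb_eq[OF finP bij d0])
    then show "d \<in> O'" using orb_shift[OF finP bij that] orb_self[of d \<tau>] unfolding O'_def by simp
  qed
  have O_al: "e \<notin> O'" if "e \<in> Dred x" "c e = z" for e
    using that O_P distinct unfolding P by auto
  \<comment> \<open>The orbit contains only darts with a \<open>y\<close>-face on the right, so
    either direction has to count as covering the edge.\<close>
  define cov where "cov e \<longleftrightarrow> e \<in> O' \<or> al e \<in> O'" for e
  have cov_sH: "cov (sH e) = cov e" if e: "e \<in> Dred x" "sg e \<in> cyc T" for e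
  proof -
    have eD: "e \<in> D" "sH e \<in> Dred x" using e Dred_x(1) sH(1) by auto
    show ?thesis
    proof (cases "c e = y")
      case True
      then have "F (sg (sg e)) \<in> T" using cyc_sg_iff[OF e(1)] e(2) by blast
      then have t: "\<tau> (al (sH e)) = e" using \<tau>_y e True by blast
      have cz: "c (sH e) = z" using sH(3)[OF e(1)] Dred_x(3)[OF e(1)] True distinct by auto
      have "e \<in> O' \<longleftrightarrow> al (sH e) \<in> O'" using O_step[OF P_al[OF eD(2) cz]] t by simp
      moreover have "c (al e) = z" using eD Dred_x(3)[OF e(1)] True distinct by auto
      then have "al e \<notin> O'" using O_al Dred_al[OF e(1)] by blast
      ultimately show ?thesis using O_al[OF eD(2) cz] unfolding cov_def by blast
    next
      case False
      then have cz: "c e = z" "c (sg e) = y" using Dred_x(3)[OF e(1)] by auto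
      have "F (sg (sg e)) \<notin> T" using cyc_sg_iff[OF e(1)] e(2) False by blast
      then have t: "\<tau> (al e) = sH e" using \<tau>_z e cz by blast
      have "sH e \<in> O' \<longleftrightarrow> al e \<in> O'" using O_step[OF P_al[OF e(1) cz(1)]] t by simp
      moreover have "c (al (sH e)) = z" using sH(4)[OF e(1)] cz Dred_x(1)[OF eD(2)] by simp
      then have "al (sH e) \<notin> O'" using O_al Dred_al[OF eD(2)] by blast
      ultimately show ?thesis using O_al[OF e(1) cz(1)] unfolding cov_def by blast
    qed
  qed
  have xdart_Dred: "xdart e = e" if "e \<in> Dred x" for e using that unfolding xdart_def by simp
  have half: "cov (xdart (al d)) = cov (xdart d)" if d: "d \<in> cyc T" "c (al d) = x" for d
  proof -
    have dD: "d \<in> D" using d cyc_subset by blast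
    define e where "e = sg (sg d)"
    have e: "e \<in> Dred x" "sg e = d" using Dred_x_I[of e] dD d unfolding e_def by simp_all
    have "e \<in> D" using Dred_x e by blast
    then have "xdart d = e" using xdart(2)[of e] xdart_Dred[OF e(1)] e(2) by simp
    moreover have "xdart (al d) = sH e"
      using xdart(2)[of "al d"] xdart_Dred[OF sH(1)[OF e(1)]] dD e(2) by simp
    ultimately show ?thesis using cov_sH[OF e(1)] e(2) d(1) by simp
  qed
  have const: "cov (xdart d) = cov (xdart e)" if "d \<in> D" "e \<in> D" for d e
  proof (rule single_cycleD[OF single, where Q = "\<lambda>d. cov (xdart d)"])
    show "cov (xdart (sg d)) = cov (xdart d)" if "d \<in> D" for d using xdart(2)[OF that] by simp
    show "cov (xdart (al d)) = cov (xdart d)" if d: "d \<in> cyc T" for d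
    proof -
      have dD: "d \<in> D" using d cyc_subset by blast
      consider "c (al d) = x" | "c d = x" | "d \<in> Dred x" using dD unfolding Dred_def by auto
      then show ?thesis
      proof cases
        case 1 then show ?thesis using half[OF d] by blast
      next
        case 2 then show ?thesis using half[OF cyc_al[OF d]] dD by simp
      next
        case 3
        then have "xdart d = d" "xdart (al d) = al d" using xdart_Dred Dred_al by blast+
        then show ?thesis using dD unfolding cov_def by auto
      qed
    qed
  qed (rule that)+
  have d0': "d0 \<in> Dred x" "d0 \<in> D" using d0 Dred_x(1) unfolding P by auto
  have "d0 \<in> O'" unfolding O'_def by (rule orb_self)
  then have "cov (xdart d0)" using xdart_Dred[OF d0'(1)] unfolding cov_def by simp
  then have cover: "e \<in> O' \<or> al e \<in> O'" if "e \<in> Dred x" for e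
    using const[of d0 e] xdart_Dred[OF that] Dred_x(1)[OF that] d0' unfolding cov_def by simp
  obtain n where n: "n > 0" "(\<tau> ^^ n) d0 = d0" "inj_on (\<lambda>i. (\<tau> ^^ i) d0) {..<n}"
    "orb \<tau> d0 = (\<lambda>i. (\<tau> ^^ i) d0) ` {..<n}"
    using orb_period[OF finP bij d0] by blast
  define ds where "ds = map (\<lambda>i. (\<tau> ^^ i) d0) [0..<n]"
  have len: "length ds = n" and nth: "\<And>i. i < n \<Longrightarrow> ds ! i = (\<tau> ^^ i) d0"
    unfolding ds_def by simp_all
  have set: "set ds = O'" unfolding ds_def O'_def n(4) by (auto simp: atLeast0LessThan)
  have nxt: "ds ! ((i + 1) mod n) = \<tau> (ds ! i)" if "i < n" for i
  proof (cases "Suc i = n")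
    case True
    then have "\<tau> ((\<tau> ^^ i) d0) = d0" using n(2) by auto
    then show ?thesis using True nth n(1) by simp
  next
    case False
    then show ?thesis using that nth by simp
  qed
  have inP: "ds ! i \<in> P" if "i < n" for i
    using that set O_P len nth_mem by blast
  have turn': "ds ! ((i + 1) mod n) = sH (al (ds ! i)) \<or> al (ds ! i) = sH (ds ! ((i + 1) mod n))"
    if "i < n" for i
    using turn[OF inP[OF that]] nxt[OF that] by simp
  have vs: "vert_of (red x) (sH e) = vert_of (red x) e" if "e \<in> Dred x" for e
    using orb_shift[OF finite_Dred bij_sg_red[OF x_in] that] unfolding vert_of_def by simp
  have "A_trail (red x) ds"
    unfolding A_trail_def eulerian_trail_def len darts_red al_red sg_red
  proof (intro conjI allI impI ballI)
    show "ds \<noteq> []" using len n(1) by auto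
    show "distinct ds" using n(3) unfolding ds_def distinct_map by (simp add: atLeast0LessThan)
    show "set ds \<subseteq> Dred x" using set O_P unfolding P by blast
    show "d \<in> set ds \<or> al d \<in> set ds" if "d \<in> Dred x" for d using cover[OF that] set by simp
    show "al d \<notin> set ds" if "d \<in> set ds" for d using that set O_P notP by blast
    fix i assume i: "i < n"
    have "(i + 1) mod n < n" using n(1) by simp
    then have "ds ! i \<in> Dred x" "ds ! ((i + 1) mod n) \<in> Dred x" using inP i unfolding P by blast+
    then show "vert_of (red x) (al (ds ! i)) = vert_of (red x) (ds ! ((i + 1) mod n))"
      using turn'[OF i] vs Dred_al by metis
    show "ds ! ((i + 1) mod n) = sH (al (ds ! i)) \<or> al (ds ! i) = sH (ds ! ((i + 1) mod n))"
      by (rule turn'[OF i])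
  qed
  then show thesis by (rule that)
qed

subsection \<open>Hamiltonian cycles\<close>

lemma vert_xdart: "d \<in> D \<Longrightarrow> vert_of M (xdart d) = vert_of M d"
  using xdart(3)[of d] by auto

lemma vert_of_cases:
  assumes "v \<in> verts M" obtains e where "e \<in> Dred x" "v = {e, sg e, sg (sg e)}"
    "e \<noteq> sg e" "e \<noteq> sg (sg e)" "sg e \<noteq> sg (sg e)"
proof -
  obtain d where d: "d \<in> D" "v = vert_of M d" using assms unfolding verts_def by blast
  have e: "xdart d \<in> Dred x" "xdart d \<in> D" using xdart(1)[OF d(1)] Dred_x(1) by auto
  have "v = {xdart d, sg (xdart d), sg (sg (xdart d))}"
    using vert_of_eq[OF e(2)] vert_xdart[OF d(1)] d(2) by simp
  moreover have "xdart d \<noteq> sg (xdart d)" "xdart d \<noteq> sg (sg (xdart d))"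
    "sg (xdart d) \<noteq> sg (sg (xdart d))"
    using c_neq[OF e(2)] c_neq[of "sg (xdart d)"] c_neq[of "sg (sg (xdart d))"] e(2) by auto
  ultimately show thesis using that e(1) by blast
qed

text \<open>The outer region is connected through its glued edges, which are not on the cycle, so
  every \<open>z\<close>-face is reached from \<open>outer\<close>. Crossing an edge that is not on
  the cycle never leaves this region, so no \<open>y\<close>-face is reached.\<close>

lemma single_cycle_imp_ham:
  assumes T: "T \<subseteq> colour_class M col x" and single: "single_cycle T"
    and outer: "outer \<in> faces M" "col outer = z"
  shows "ham_cycle M (cyc T)"
    and "f \<in> colour_class M col y \<Longrightarrow> inside_cycle M outer (cyc T) f"
    and "f \<in> colour_class M col z \<Longrightarrow> outside_cycle M outer (cyc T) f"
proof -
  let ?R = "{(vert_of M d, vert_of M (al d)) | d. d \<in> cyc T}"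
  show "ham_cycle M (cyc T)"
    unfolding ham_cycle_def
  proof (intro conjI ballI)
    show "cyc T \<subseteq> D" by (rule cyc_subset)
    show "al d \<in> cyc T" if "d \<in> cyc T" for d using cyc_al[OF that] .
    show "card (v \<inter> cyc T) = 2" if v: "v \<in> verts M" for v
    proof -
      obtain e where e: "e \<in> Dred x" "v = {e, sg e, sg (sg e)}"
        "e \<noteq> sg e" "e \<noteq> sg (sg e)" "sg e \<noteq> sg (sg e)"
        using vert_of_cases[OF v] .
      have "v \<inter> cyc T = {e, if sg e \<in> cyc T then sg e else sg (sg e)}"
        using cyc_Dred[OF e(1)] cyc_sg_sg_iff[OF e(1)] e(2) by auto
      then show ?thesis using e(3,4) by simp
    qed
    show "(u, v) \<in> ?R\<^sup>*" if uv: "u \<in> verts M" "v \<in> verts M" for u v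
    proof -
      obtain d e where de: "d \<in> D" "e \<in> D" "u = vert_of M d" "v = vert_of M e"
        using uv unfolding verts_def by blast
      have "((u, vert_of M d) \<in> ?R\<^sup>*) = ((u, vert_of M e) \<in> ?R\<^sup>*)"
      proof (rule single_cycleD[OF single, where Q = "\<lambda>d. (u, vert_of M d) \<in> ?R\<^sup>*"])
        show "((u, vert_of M (al d)) \<in> ?R\<^sup>*) = ((u, vert_of M d) \<in> ?R\<^sup>*)" if d: "d \<in> cyc T" for d
        proof -
          have "d \<in> D" using d cyc_subset by blast
          then have "(vert_of M d, vert_of M (al d)) \<in> ?R" "(vert_of M (al d), vert_of M d) \<in> ?R"
            using d cyc_al[OF d] al_al by (blast, metis (mono_tags, lifting) mem_Collect_eq)
          then show ?thesis by (meson rtrancl.rtrancl_into_rtrancl)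
        qed
      qed (use de in simp_all)
      then show ?thesis using de by simp
    qed
  qed
  interpret sw: coloured_cubic_map M col x z y by (rule swap_colours)
  define U where "U = colour_class M col x - T"
  have U: "U \<subseteq> colour_class M col x" "sw.single_cycle U"
    using single swap_single_cycle unfolding U_def by auto
  let ?S = "{(F d, F (al d)) | d. d \<in> D - cyc T}"
  have outer_in: "outer \<in> sw.nodes U" using outer unfolding sw.nodes_def colour_class_def by blast
  show "outside_cycle M outer (cyc T) f" if f: "f \<in> colour_class M col z"
  proof -
    have "((outer, outer) \<in> ?S\<^sup>*) = ((outer, f) \<in> ?S\<^sup>*)"
    proof (rule connD[OF sw.single_cycle_imp_conn[OF U], where Q = "\<lambda>f. (outer, f) \<in> ?S\<^sup>*"])
      fix i assume i: "i \<in> sw.glue U"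
      then have iD: "i \<in> D" "c i = x" "c (al i) = z" "F i \<notin> T" unfolding sw.glue_def U_def by blast+
      then have nc: "i \<notin> cyc T" using distinct unfolding cyc_def by simp
      then have "al i \<notin> cyc T" using cyc_al[of "al i"] iD by auto
      then have "(F i, F (al i)) \<in> ?S" "(F (al i), F (al (al i))) \<in> ?S" using nc iD(1) al_in by blast+
      then show "((outer, F i) \<in> ?S\<^sup>*) = ((outer, F (al i)) \<in> ?S\<^sup>*)"
        using al_al[OF iD(1)] by (metis (no_types, lifting) rtrancl.rtrancl_into_rtrancl)
    next
      show "f \<in> sw.nodes U" using f unfolding sw.nodes_def by blast
    qed (rule outer_in)
    then show ?thesis unfolding outside_cycle_def by simp
  qed
  show "inside_cycle M outer (cyc T) f" if f: "f \<in> colour_class M col y"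
  proof -
    have closed: "F (al d) \<in> sw.nodes U" if d: "d \<in> D" "d \<notin> cyc T" "F d \<in> sw.nodes U" for d
    proof -
      have "\<not> (c d = y)" using d(3) distinct unfolding sw.nodes_def U_def colour_class_def by auto
      moreover have "c d = x \<Longrightarrow> F d \<notin> T"
        using d(3) distinct unfolding sw.nodes_def U_def colour_class_def by auto
      ultimately show ?thesis
        using d(2) by (rule_tac col_cases[OF d(1)])
          (use d(1) distinct in \<open>simp_all add: cyc_def sw.nodes_def U_def colour_class_def\<close>)
    qed
    have "g \<in> sw.nodes U" if "(outer, g) \<in> ?S\<^sup>*" for g
      using that
    proof (induction rule: rtrancl_induct)
      case (step p q)
      then show ?case using closed by blast
    qed (rule outer_in)
    moreover have "f \<notin> sw.nodes U"
      using f distinct unfolding sw.nodes_def U_def colour_class_def by auto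
    ultimately show ?thesis
      using f unfolding inside_cycle_def outside_cycle_def colour_class_def by blast
  qed
qed

text \<open>An edge between an inside face and an outside face lies on \<open>C\<close>, so each
  vertex has its edge between a \<open>y\<close>-face and a \<open>z\<close>-face on
  \<open>C\<close>. Exactly one of the other two edges there is on \<open>C\<close> as well, so
  membership in \<open>C\<close> alternates around every \<open>x\<close>-face.\<close>

lemma ham_imp_single_cycle:
  assumes ham: "ham_cycle M C"
    and inside: "\<And>f. f \<in> colour_class M col y \<Longrightarrow> inside_cycle M outer C f"
    and outside: "\<And>f. f \<in> colour_class M col z \<Longrightarrow> outside_cycle M outer C f"
  obtains T where "T \<subseteq> colour_class M col x" "single_cycle T"
proof -
  have C: "C \<subseteq> D" "\<And>d. d \<in> C \<Longrightarrow> al d \<in> C" "\<And>v. v \<in> verts M \<Longrightarrow> card (v \<inter> C) = 2"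
    using ham unfolding ham_cycle_def by blast+
  have C_al: "al d \<in> C \<longleftrightarrow> d \<in> C" if "d \<in> D" for d
    using C(2)[of d] C(2)[of "al d"] that by auto
  have zy: "d \<in> C" if d: "d \<in> D" "c d = z" "c (al d) = y" for d
  proof (rule ccontr)
    assume "d \<notin> C"
    then have "(F d, F (al d)) \<in> {(F d, F (al d)) | d. d \<in> D - C}" using d by blast
    moreover have "outside_cycle M outer C (F d)"
      using outside d unfolding colour_class_def by simp
    ultimately have "outside_cycle M outer C (F (al d))"
      unfolding outside_cycle_def by (rule rtrancl_into_rtrancl[rotated])
    moreover have "F (al d) \<in> colour_class M col y"
      unfolding colour_class_def using d F_in_faces[OF al_in[OF d(1)]] by blast
    ultimately show False using inside unfolding inside_cycle_def by blast
  qed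
  have red_C: "e \<in> C" if "e \<in> Dred x" for e
    using Dred_x[OF that] zy[of e] zy[of "al e"] C_al[of e] by auto
  have one: "sg (sg e) \<in> C \<longleftrightarrow> sg e \<notin> C" if e: "e \<in> Dred x" for e
  proof -
    have eD: "e \<in> D" using Dred_x e by blast
    have "card ({e, sg e, sg (sg e)} \<inter> C) = 2"
      using C(3)[OF vert_in_verts[OF eD]] vert_of_eq[OF eD] by simp
    moreover have "e \<noteq> sg e" "e \<noteq> sg (sg e)" "sg e \<noteq> sg (sg e)"
      using c_neq[OF eD] c_neq[of "sg e"] c_neq[of "sg (sg e)"] eD by auto
    ultimately show ?thesis using red_C[OF e]
      by (cases "sg e \<in> C"; cases "sg (sg e) \<in> C") (simp_all add: Int_insert_left)
  qed
  have alt: "sg (al d) \<in> C \<longleftrightarrow> d \<notin> C" if d: "d \<in> D" "c d = x" for d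
  proof -
    have "sg (sg (al d)) \<in> Dred x" using Dred_x_I[of "sg (sg (al d))"] d by simp
    from one[OF this] show ?thesis using d C_al by simp
  qed
  \<comment> \<open>\<open>good d\<close> says that \<open>C\<close> treats the edge of
    \<open>d\<close> as \<open>cyc T\<close> does on a face in \<open>T\<close>. From one dart of an
    \<open>x\<close>-face to the next both sides of the equivalence flip, so it holds for all darts
    of the face or for none.\<close>
  define good where "good d \<longleftrightarrow> (c (sg d) = z \<longleftrightarrow> d \<in> C)" for d
  have good_step: "good (sg (al d)) = good d" if d: "d \<in> D" "c d = x" for d
  proof -
    have "c (sg (sg (al d))) = z \<longleftrightarrow> c (sg d) \<noteq> z"
      by (rule col_cases[OF d(1)]) (use d distinct in simp_all)
    then show ?thesis using alt[OF d] unfolding good_def by blast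
  qed
  have good_face: "good e = good d" if "d \<in> D" "c d = x" "e \<in> F d" for d e
    by (rule F_induct[OF that(1,3)]) (use good_step that(2) in simp_all)
  define T where "T = {F d | d. d \<in> D \<and> c d = x \<and> c (sg d) = z \<and> d \<in> C}"
  have T_sub: "T \<subseteq> colour_class M col x" unfolding T_def colour_class_def by auto
  have T_good: "F d \<in> T \<longleftrightarrow> good d" if d: "d \<in> D" "c d = x" for d
  proof
    assume "F d \<in> T"
    then obtain e where e: "F d = F e" "e \<in> D" "c e = x" "c (sg e) = z" "e \<in> C"
      unfolding T_def by blast
    then have "good e" unfolding good_def by blast
    then show "good d" using good_face[OF d, of e] F_mem[OF d(1)] e by simp
  next
    assume g: "good d"
    show "F d \<in> T"
    proof (cases "c (sg d) = z")
      case True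
      then show ?thesis using g d unfolding T_def good_def by blast
    next
      case False
      then have "c (sg (sg (al d))) = z"
        by (rule_tac col_cases[OF d(1)]) (use d distinct in simp_all)
      moreover have "sg (al d) \<in> C" using alt[OF d] g False unfolding good_def by blast
      ultimately have "F (sg (al d)) \<in> T"
        unfolding T_def using d by (intro CollectI exI[of _ "sg (al d)"]) simp
      then show ?thesis using d by simp
    qed
  qed
  have x_iff: "d \<in> C \<longleftrightarrow> (c (al d) = z \<longleftrightarrow> F d \<in> T)" if d: "d \<in> D" "c d = x" for d
    using T_good[OF d] d unfolding good_def by auto
  have C_cyc: "d \<in> C" if d: "d \<in> cyc T" for d
  proof -
    have dD: "d \<in> D" using d cyc_subset by blast
    consider "d \<in> Dred x" | "c d = x" "c (al d) = z \<longleftrightarrow> F d \<in> T"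
      | "c (al d) = x" "c d = z \<longleftrightarrow> F (al d) \<in> T"
      using d dD unfolding cyc_def Dred_def by auto
    then show ?thesis
    proof cases
      case 1 then show ?thesis by (rule red_C)
    next
      case 2 then show ?thesis using x_iff[OF dD] by blast
    next
      case 3
      then have "al d \<in> C" using x_iff[of "al d"] dD al_al[OF dD] al_in[OF dD] by metis
      then show ?thesis using C_al[OF dD] by blast
    qed
  qed
  have cyc_C: "d \<in> cyc T" if d: "d \<in> C" for d
  proof -
    have dD: "d \<in> D" using d C(1) by blast
    consider "d \<in> Dred x" | "c d = x" | "c (al d) = x" using dD unfolding Dred_def by auto
    then show ?thesis
    proof cases
      case 1 then show ?thesis by (rule cyc_Dred)
    next
      case 2 then show ?thesis using x_iff[OF dD] d dD unfolding cyc_def by blast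
    next
      case 3
      then have "c d = z \<longleftrightarrow> F (al d) \<in> T"
        using x_iff[of "al d"] dD al_al[OF dD] al_in[OF dD] C(2)[OF d] by metis
      then show ?thesis using 3 dD unfolding cyc_def by blast
    qed
  qed
  have "single_cycle T"
  proof (rule single_cycleI)
    fix Q :: "'d \<Rightarrow> bool" and d e
    assume Qs: "\<And>d. d \<in> D \<Longrightarrow> Q (sg d) = Q d" and Qc: "\<And>d. d \<in> cyc T \<Longrightarrow> Q (al d) = Q d"
      and de: "d \<in> D" "e \<in> D"
    have Qv: "Q i = Q j" if "i \<in> D" "j \<in> D" "vert_of M i = vert_of M j" for i j
    proof -
      have "i = j \<or> i = sg j \<or> i = sg (sg j)"
        using vert_of_mem[OF that(2), of i] vert_of_eq[OF that(2)] that by auto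
      then show ?thesis using Qs that(2) by auto
    qed
    have "(vert_of M d, vert_of M e) \<in> {(vert_of M d, vert_of M (al d)) | d. d \<in> C}\<^sup>*"
      using ham de unfolding ham_cycle_def by simp
    then have "\<forall>i\<in>D. vert_of M i = vert_of M e \<longrightarrow> Q d = Q i"
    proof (induction rule: rtrancl_induct)
      case base
      then show ?case using Qv de by metis
    next
      case (step p q)
      then obtain k where k: "k \<in> C" "p = vert_of M k" "q = vert_of M (al k)" by blast
      have kD: "k \<in> D" "al k \<in> D" using k C(1) by auto
      have "Q d = Q k" using step(3) k kD by blast
      then have "Q d = Q (al k)" using Qc[OF cyc_C[OF k(1)]] by simp
      then show ?case using Qv kD k(3) by metis
    qed
    then show "Q d = Q e" using de by blast
  qed
  then show thesis using that T_sub by blast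
qed

section \<open>Each statement as the existence of a set \<open>T\<close> whose 2-factor is a single
  cycle\<close>

lemma ham_iff:
  assumes "outer \<in> faces M" "col outer = z"
  shows "(\<exists>C. ham_cycle M C \<and> (\<forall>f\<in>colour_class M col y. inside_cycle M outer C f)
      \<and> (\<forall>f\<in>colour_class M col z. outside_cycle M outer C f))
    \<longleftrightarrow> (\<exists>T \<subseteq> colour_class M col x. single_cycle T)"
proof
  assume "\<exists>C. ham_cycle M C \<and> (\<forall>f\<in>colour_class M col y. inside_cycle M outer C f)
      \<and> (\<forall>f\<in>colour_class M col z. outside_cycle M outer C f)"
  then show "\<exists>T \<subseteq> colour_class M col x. single_cycle T"
    using ham_imp_single_cycle by metis
next
  assume "\<exists>T \<subseteq> colour_class M col x. single_cycle T"
  then show "\<exists>C. ham_cycle M C \<and> (\<forall>f\<in>colour_class M col y. inside_cycle M outer C f)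
      \<and> (\<forall>f\<in>colour_class M col z. outside_cycle M outer C f)"
    using single_cycle_imp_ham[OF _ _ assms] by blast
qed

lemma A_trail_iff:
  "(\<exists>ds. A_trail (red x) ds) \<longleftrightarrow> (\<exists>T \<subseteq> colour_class M col x. single_cycle T)"
  using A_trail_imp_single_cycle single_cycle_imp_A_trail by metis

lemma swap_ex_single_cycle:
  "(\<exists>T \<subseteq> colour_class M col x. coloured_cubic_map.single_cycle M col x y T)
    \<longleftrightarrow> (\<exists>T \<subseteq> colour_class M col x. single_cycle T)"
proof
  assume "\<exists>T \<subseteq> colour_class M col x. coloured_cubic_map.single_cycle M col x y T"
  then obtain T where T: "T \<subseteq> colour_class M col x" "coloured_cubic_map.single_cycle M col x y T" by blast
  have "colour_class M col x - (colour_class M col x - T) = T" using T(1) by blast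
  then have "single_cycle (colour_class M col x - T)"
    using T(2) swap_single_cycle[of "colour_class M col x - T"] by simp
  then show "\<exists>T \<subseteq> colour_class M col x. single_cycle T" by blast
next
  assume "\<exists>T \<subseteq> colour_class M col x. single_cycle T"
  then show "\<exists>T \<subseteq> colour_class M col x. coloured_cubic_map.single_cycle M col x y T"
    using swap_single_cycle by blast
qed

end

theorem theorem2:
  fixes G :: "'d cmap" and col :: "'d set \<Rightarrow> nat" and outer :: "'d set"
  assumes "plane_map G" and "simple_map G" and "three_connected G"
    and "cubic_map G" and "bipartite_map G"
    and "proper_3_face_colouring G col"
    and "outer \<in> faces G" and "col outer = 3"
  defines "H \<equiv> reduced_graph G col 1"
    and "H' \<equiv> reduced_graph G col 2"
    and "H'' \<equiv> reduced_graph G col 3"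
  shows "((\<exists>C. ham_cycle G C \<and>
             (\<forall>f\<in>colour_class G col 2. inside_cycle G outer C f) \<and>
             (\<forall>f\<in>colour_class G col 3. outside_cycle G outer C f))
          \<longleftrightarrow> (\<exists>ds. A_trail H ds))
       \<and> ((\<exists>ds. A_trail H ds)
          \<longleftrightarrow> (\<exists>T. (\<forall>f\<in>T. face_from_colour G col 1 H' f) \<and>
                    spanning_tree_of_faces H' (face_of H' (SOME d. d \<in> outer \<and> d \<in> cm_darts H')) T))
       \<and> ((\<exists>T. (\<forall>f\<in>T. face_from_colour G col 1 H' f) \<and>
                 spanning_tree_of_faces H' (face_of H' (SOME d. d \<in> outer \<and> d \<in> cm_darts H')) T)
          \<longleftrightarrow> (\<exists>o''. face_from_colour G col 2 H'' o'' \<and>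
                 (\<exists>T. (\<forall>f\<in>T. face_from_colour G col 1 H'' f) \<and> spanning_tree_of_faces H'' o'' T)))"
proof -
  interpret coloured_cubic_map G col 1 2 3
    using assms(1-6) unfolding proper_3_face_colouring_def
    by unfold_locales auto
  \<comment> \<open>In this instance \<open>H''\<close> plays the part that \<open>H'\<close> plays
    in the first one.\<close>
  interpret sw: coloured_cubic_map G col 1 3 2 by (rule swap_colours)
  let ?S = "\<exists>T \<subseteq> colour_class G col 1. single_cycle T"
  have "(\<exists>T. (\<forall>f\<in>T. face_from_colour G col 1 H' f) \<and>
      spanning_tree_of_faces H' (face_of H' (SOME d. d \<in> outer \<and> d \<in> cm_darts H')) T) \<longleftrightarrow> ?S"
    unfolding H'_def
  proof (rule spanning_tree_of_faces_iff)
    \<comment> \<open>The outer face has colour 3, so it keeps darts in \<open>H'\<close>; the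
      chosen dart is one of them and determines a face that comes from a 3-face.\<close>
    let ?d = "SOME d. d \<in> outer \<and> d \<in> cm_darts (reduced_graph G col 2)"
    obtain d where d: "d \<in> Dred 2" "outer = F d" using face_dart[of outer 2] assms(7,8) by auto
    have dD: "d \<in> D" using d Dred_subset by blast
    have "d \<in> outer \<and> d \<in> cm_darts (reduced_graph G col 2)" using d F_mem[OF dD, of d] dD by simp
    then have "?d \<in> outer \<and> ?d \<in> cm_darts (reduced_graph G col 2)" by (rule someI)
    then have o: "?d \<in> Dred 2" "c ?d = 3" using F_mem[OF dD] d(2) assms(8) by auto
    show "\<not> face_from_colour G col 1 (reduced_graph G col 2) (face_of (reduced_graph G col 2) ?d)"
      using face_from_colour_unique[OF face_of_red_colour[OF o(1)], of 1] o(2) by auto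
  qed
  moreover have "(\<exists>o''. face_from_colour G col 2 H'' o'' \<and>
      (\<exists>T. (\<forall>f\<in>T. face_from_colour G col 1 H'' f) \<and> spanning_tree_of_faces H'' o'' T)) \<longleftrightarrow> ?S"
  proof -
    \<comment> \<open>The outer face of \<open>G\<close> is contracted in \<open>H''\<close>, so a
      face coming from a 2-face is taken as the outer one. The equivalence \<open>iff\<close> holds
      for each such face, and it remains to see that there is one.\<close>
    have ex: "\<exists>f. face_from_colour G col 2 H'' f"
    proof -
      obtain d where d: "d \<in> D" using D_nonempty by blast
      then have "F (ydart d) \<in> faces G" "col (F (ydart d)) = 2" using ydart[OF d] by auto
      then obtain e where "e \<in> Dred 3" "F (ydart d) = F e" using face_dart[of "F (ydart d)" 3] by auto
      then show ?thesis
        using face_of_red_colour[of e 3] \<open>col (F (ydart d)) = 2\<close> unfolding H''_def by auto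
    qed
    have iff: "(\<exists>T. (\<forall>f\<in>T. face_from_colour G col 1 H'' f) \<and> spanning_tree_of_faces H'' f0 T) \<longleftrightarrow> ?S"
      if "face_from_colour G col 2 H'' f0" for f0
    proof -
      have "\<not> face_from_colour G col 1 (reduced_graph G col 3) f0"
        using face_from_colour_unique[of 2 3 f0 1] that unfolding H''_def by auto
      from sw.spanning_tree_of_faces_iff[OF this] show ?thesis
        unfolding swap_ex_single_cycle H''_def .
    qed
    show ?thesis
    proof
      assume "\<exists>o''. face_from_colour G col 2 H'' o'' \<and>
        (\<exists>T. (\<forall>f\<in>T. face_from_colour G col 1 H'' f) \<and> spanning_tree_of_faces H'' o'' T)"
      then obtain f0 where "face_from_colour G col 2 H'' f0"
        "\<exists>T. (\<forall>f\<in>T. face_from_colour G col 1 H'' f) \<and> spanning_tree_of_faces H'' f0 T"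
        by blast
      then show ?S using iff[of f0] by simp
    next
      assume ?S
      obtain f0 where f0: "face_from_colour G col 2 H'' f0" using ex by (elim exE)
      from iff[OF f0] \<open>?S\<close> f0 show "\<exists>o''. face_from_colour G col 2 H'' o'' \<and>
        (\<exists>T. (\<forall>f\<in>T. face_from_colour G col 1 H'' f) \<and> spanning_tree_of_faces H'' o'' T)"
        by (intro exI[of _ f0]) simp
    qed
  qed
  moreover have "(\<exists>ds. A_trail H ds) \<longleftrightarrow> ?S" unfolding H_def by (rule A_trail_iff)
  moreover have "(\<exists>C. ham_cycle G C \<and> (\<forall>f\<in>colour_class G col 2. inside_cycle G outer C f) \<and>
      (\<forall>f\<in>colour_class G col 3. outside_cycle G outer C f)) \<longleftrightarrow> ?S"
    by (rule ham_iff[OF assms(7,8)])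
  ultimately show ?thesis by argo
qed

end
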